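(* Assume that the kernel $\Sigma_0$ is continuously differentiable and bounded, and that there is a non-negative function $h$ such that $\int h(x,w',x')p(w')\,dw'$ is finite for all $x,x'\in A$ and $\left|\frac{\partial\Sigma_0(x,w',x',w)}{\partial w}\right|<h(x,w',x')$ for all $x,x'\in A$ and $w,w'\in W$. Let $(x_{n+1},w_{n+1})\in A\times W$ be given and suppose that $\arg\max_{x'\in A}\big(a_n(x')+\tilde\sigma_n(x',x_{n+1},w_{n+1})Z\big)$ is almost surely a singleton, where $Z$ is a standard normal random variable. Assume also that $\Sigma_n(x_{n+1},w_{n+1},x_{n+1},w_{n+1})>0$ and that $\lambda_{(x,w)}$ is continuously differentiable at $x=x_{n+1}$, $w=w_{n+1}$. Let $\{Z_i\}_{i=1}^\infty$ be independent standard normal random variables and let $y_i=\arg\max_{x'\in A}\big(a_n(x')+\tilde\sigma_n(x',x_{n+1},w_{n+1})Z_i\big)$. Then $$\nabla V_n(x_{n+1},w_{n+1})=\lim_{m\to\infty}\frac1m\sum_{i=1}^m\nabla_{(x_{n+1},w_{n+1})}\tilde\sigma_n(y_i,x_{n+1},w_{n+1})\,Z_i\quad\text{a.s.},$$ where in each term the gradient is taken with $y_i$ held fixed. Furthermore, for all $i$, $$E\big[\nabla_{(x_{n+1},w_{n+1})}\tilde\sigma_n(y_i,x_{n+1},w_{n+1})\,Z_i\big]=\nabla V_n(x_{n+1},w_{n+1}).$$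
   Context: $A\subset\mathbb{R}^d$ is compact, $W$ is a set of vectors in a Euclidean space, and $p$ is a known finite density on $W$. $F$ has a Gaussian process prior on $A\times W$ with mean function $\mu_0$ and kernel $\Sigma_0$, and $F(x,\cdot)p(\cdot)$ is integrable for each $x$. Observing at $(x,w)$ yields $F(x,w)$ plus independent normal noise with mean $0$ and variance $\lambda_{(x,w)}\ge0$ (noise-free when it is $0$). $H_n$ is the history of the first $n$ sampled points $(x_i,w_i)$ and the corresponding observations (fixed here); $\mu_n,\Sigma_n$ are the posterior mean function and covariance kernel of $F$ given $H_n$. $G(x)=\int F(x,w)p(w)\,dw$ and $a_n(x)=\int\mu_n(x,w)p(w)\,dw$ is its posterior mean. For $x',x\in A$, $w\in W$, $$\tilde\sigma_n(x',x,w)=\frac{\int\Sigma_n(x',w',x,w)p(w')\,dw'}{\sqrt{\Sigma_n(x,w,x,w)+\lambda_{(x,w)}}},$$ with $\tilde\sigma_n(x',x,w)=0$ if $\lambda_{(x,w)}=0$ and $(x,w)$ is one of the points already sampled. Conditionally on $H_n$ and on sampling next at $(x,w)$, the function $a_{n+1}(\cdot)$ is distributed as $a_n(\cdot)+\tilde\sigma_n(\cdot,x,w)Z$ with $Z$ standard normal. The value of information is $$V_n(x,w)=E\Big[\max_{x'\in A}\big(a_n(x')+\tilde\sigma_n(x',x,w)Z\big)\Big]-\max_{x'\in A}a_n(x').$$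
   Formalization: Added: a_n is continuous on A; near (x_{n+1},w_{n+1}), Σ_0(x,w',·) is Lipschitz at that point with constant k(w') uniform in x∈A, ∫k p finite (h alone does not make σ̃_n differentiable); partial derivatives make sense there within A×W. *)

theory Defs
  imports "HOL-Probability.Probability"
begin

(* Variance 0 is allowed: noise-free observations and degenerate kernels. *)
definition normal_law :: "real \<Rightarrow> real \<Rightarrow> real measure" where
  "normal_law m v = (if v = 0 then return borel m else density lborel (normal_density m (sqrt v)))"

abbreviation std_normal :: "real measure" where
  "std_normal \<equiv> density lborel (\<lambda>z. ennreal (std_normal_density z))"

(* Every finite linear combination is normal with the mean and variance given by m and k. *)
definition gaussian_process ::
  "'s measure \<Rightarrow> 't set \<Rightarrow> ('t \<Rightarrow> 's \<Rightarrow> real) \<Rightarrow> ('t \<Rightarrow> real) \<Rightarrow> ('t \<Rightarrow> 't \<Rightarrow> real) \<Rightarrow> bool" where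
  "gaussian_process M T F m k \<longleftrightarrow>
     (\<forall>t\<in>T. F t \<in> borel_measurable M) \<and>
     (\<forall>s\<in>T. \<forall>t\<in>T. k s t = k t s) \<and>
     (\<forall>J c. finite J \<and> J \<subseteq> T \<longrightarrow>
        0 \<le> (\<Sum>s\<in>J. \<Sum>t\<in>J. c s * c t * k s t) \<and>
        distr M borel (\<lambda>\<omega>. \<Sum>t\<in>J. c t * F t \<omega>) =
          normal_law (\<Sum>t\<in>J. c t * m t) (\<Sum>s\<in>J. \<Sum>t\<in>J. c s * c t * k s t))"

definition generated_algebra :: "'s measure \<Rightarrow> 'i set \<Rightarrow> ('i \<Rightarrow> 's \<Rightarrow> real) \<Rightarrow> 's measure" where
  "generated_algebra M I X = sigma (space M) {X i -` B \<inter> space M | i B. i \<in> I \<and> B \<in> sets borel}"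

(* Independent normal noises, jointly independent of the whole process F. *)
definition observation_noise ::
  "'s measure \<Rightarrow> 't set \<Rightarrow> ('t \<Rightarrow> 's \<Rightarrow> real) \<Rightarrow> nat \<Rightarrow> (nat \<Rightarrow> 't) \<Rightarrow> ('t \<Rightarrow> real) \<Rightarrow>
   (nat \<Rightarrow> 's \<Rightarrow> real) \<Rightarrow> bool" where
  "observation_noise M T F n pt lam \<epsilon> \<longleftrightarrow>
     (\<forall>i<n. distr M borel (\<epsilon> i) = normal_law 0 (lam (pt i))) \<and>
     prob_space.indep_vars M (\<lambda>_. borel) \<epsilon> {..<n} \<and>
     prob_space.indep_set M (sets (generated_algebra M T F)) (sets (generated_algebra M {..<n} \<epsilon>))"

(* Posterior mean and covariance of F given the observations Y 0, ..., Y (n - 1), at the fixed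
   observed values yobs.  A conditional expectation is only determined almost surely; in the
   Gaussian case it has a version that is affine in the observations, and mu is that version
   evaluated at yobs.  The conditional covariance is almost surely a constant, namely K s t. *)
definition posterior ::
  "'s measure \<Rightarrow> 't set \<Rightarrow> ('t \<Rightarrow> 's \<Rightarrow> real) \<Rightarrow> nat \<Rightarrow> (nat \<Rightarrow> 's \<Rightarrow> real) \<Rightarrow> (nat \<Rightarrow> real) \<Rightarrow>
   ('t \<Rightarrow> real) \<Rightarrow> ('t \<Rightarrow> 't \<Rightarrow> real) \<Rightarrow> bool" where
  "posterior M T F n Y yobs \<mu> K \<longleftrightarrow>
     (let E = real_cond_exp M (generated_algebra M {..<n} Y) in
       (\<forall>t\<in>T. \<exists>b c. (AE \<omega> in M. E (F t) \<omega> = b + (\<Sum>i<n. c i * Y i \<omega>)) \<and>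
                    \<mu> t = b + (\<Sum>i<n. c i * yobs i)) \<and>
       (\<forall>s\<in>T. \<forall>t\<in>T. AE \<omega> in M.
          E (\<lambda>\<omega>'. (F s \<omega>' - E (F s) \<omega>') * (F t \<omega>' - E (F t) \<omega>')) \<omega> = K s t))"

definition integrated_mean ::
  "('a \<times> 'b::euclidean_space \<Rightarrow> real) \<Rightarrow> ('b \<Rightarrow> real) \<Rightarrow> 'b set \<Rightarrow> 'a \<Rightarrow> real" where
  "integrated_mean \<mu> p W x = (LINT w:W|lborel. \<mu> (x, w) * p w)"

definition sigma_tilde ::
  "('a \<times> 'b::euclidean_space \<Rightarrow> 'a \<times> 'b \<Rightarrow> real) \<Rightarrow> ('a \<times> 'b \<Rightarrow> real) \<Rightarrow> ('b \<Rightarrow> real) \<Rightarrow> 'b set \<Rightarrow>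
   ('a \<times> 'b) set \<Rightarrow> 'a \<Rightarrow> 'a \<times> 'b \<Rightarrow> real" where
  "sigma_tilde K lam p W sampled x' z =
     (if lam z = 0 \<and> z \<in> sampled then 0
      else (LINT w':W|lborel. K (x', w') z * p w') / sqrt (K z z + lam z))"

definition value_of_information ::
  "('a \<Rightarrow> real) \<Rightarrow> ('a \<Rightarrow> 'c \<Rightarrow> real) \<Rightarrow> 'a set \<Rightarrow> 'c \<Rightarrow> real" where
  "value_of_information a s A z =
     (\<integral>\<zeta>. (SUP x'\<in>A. a x' + s x' z * \<zeta>) \<partial>std_normal) - (SUP x'\<in>A. a x')"

(* S need not be open: f is the restriction to S of a C1 function on an open neighbourhood of S. *)
definition C1_on :: "('c::euclidean_space \<Rightarrow> real) \<Rightarrow> 'c set \<Rightarrow> bool" where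
  "C1_on f S \<longleftrightarrow>
     (\<exists>U f' g. open U \<and> S \<subseteq> U \<and> (\<forall>u\<in>S. f' u = f u) \<and>
        (\<forall>u\<in>U. GDERIV f' u :> g u) \<and> continuous_on U g)"

definition has_gradient_within ::
  "('c::euclidean_space \<Rightarrow> real) \<Rightarrow> 'c \<Rightarrow> 'c \<Rightarrow> 'c set \<Rightarrow> bool" where
  "has_gradient_within f D z S \<longleftrightarrow> (f has_derivative (\<lambda>h. h \<bullet> D)) (at z within S)"

definition gradient :: "('c::euclidean_space \<Rightarrow> real) \<Rightarrow> 'c set \<Rightarrow> 'c \<Rightarrow> 'c" where
  "gradient f S z = (THE D. has_gradient_within f D z S)"

(* Partial derivatives at z of a function on S are meaningful: z can be approached within S along
   every coordinate axis.  True at interior points, and also at boundary points of a box. *)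
definition partials_meaningful :: "'c::euclidean_space set \<Rightarrow> 'c \<Rightarrow> bool" where
  "partials_meaningful S z \<longleftrightarrow>
     (\<forall>i\<in>Basis. \<forall>e>0. \<exists>d. 0 < \<bar>d\<bar> \<and> \<bar>d\<bar> < e \<and> z + d *\<^sub>R i \<in> S)"

lemma partials_meaningful_interior:
  assumes "z \<in> interior S"
  shows "partials_meaningful S z"
  unfolding partials_meaningful_def
proof (intro ballI allI impI)
  fix i :: 'a and e :: real
  assume i: "i \<in> Basis" and e: "e > 0"
  obtain r where r: "r > 0" "ball z r \<subseteq> S"
    using assms mem_interior by blast
  have "z + (min r e / 2) *\<^sub>R i \<in> S"
    using r e i by (intro subsetD[OF r(2)]) (auto simp: dist_norm)
  then show "\<exists>d. 0 < \<bar>d\<bar> \<and> \<bar>d\<bar> < e \<and> z + d *\<^sub>R i \<in> S"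
    using r e by (intro exI[of _ "min r e / 2"]) auto
qed

lemma has_gradient_within_unique:
  assumes "partials_meaningful S z" "has_gradient_within f D z S" "has_gradient_within f D' z S"
  shows "D = D'"
proof -
  have "(\<lambda>h. h \<bullet> D) = (\<lambda>h. h \<bullet> D')"
    using assms unfolding has_gradient_within_def partials_meaningful_def
    by (intro frechet_derivative_unique_within[of f _ z S]) auto
  then show ?thesis
    by (metis vector_eq_ldot)
qed

lemma gradient_eq:
  assumes "partials_meaningful S z" "has_gradient_within f D z S"
  shows "gradient f S z = D"
  unfolding gradient_def using assms has_gradient_within_unique by (intro the_equality) blast+

end

theory Submission
  imports Defs
begin

text \<open>Orthogonality of the posterior residuals to the observations makes \<open>\<Sigma>n s t\<close> equal to
  \<open>\<Sigma>0 s t\<close> minus a fixed bilinear form in the vectors \<open>(\<Sigma>0 s (pt i))\<^sub>i\<close> and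
  \<open>(\<Sigma>0 t (pt j))\<^sub>j\<close>, so the smoothness of \<open>\<Sigma>0\<close> passes to \<open>\<sigma>\<close>.  The derivative of
  \<open>\<sigma> x\<close> at \<open>z0 = (x0, w0)\<close> exists uniformly along \<open>x \<longlonglongrightarrow> y\<close>; since the maximiser is almost surely
  unique, Danskin's theorem differentiates the maximum for almost every \<open>\<zeta>\<close>, with gradient
  \<open>\<psi> \<zeta> = \<zeta> \<nabla>\<sigma> (y \<zeta>) z0\<close>, and dominated convergence moves the gradient out of the expectation.
  Being a limit of difference quotients of the maximum, \<open>\<psi>\<close> is Borel measurable, so the terms
  of the estimator are almost surely equal to the i.i.d. variables \<open>\<psi> (Z i)\<close>, which have finite
  fourth moments; the strong law of large numbers is then a fourth moment estimate.\<close>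

text \<open>\<open>A \<times> W\<close> need be neither open nor convex, and \<open>W\<close> may be
  unbounded. Derivatives are therefore taken within \<open>A \<times> W\<close>, the mean value
  theorem is used only on balls inside the open set that carries the C1 extension of the prior
  kernel, and components of gradients are recovered along sequences on the coordinate axes, which
  \<open>partials_meaningful\<close> supplies. Since \<open>W\<close> may be unbounded, continuity
  of the derivative does not justify differentiating under the integral; the integrable Lipschitz
  bound \<open>k\<close> does. The covariance matrix of the observations can be singular (repeated
  or noise-free points), which is why a generalised inverse appears. Uniformity in \<open>x\<close>
  is required because the maximiser moves with the point. Compactness of \<open>A\<close> turns it
  into a single Lipschitz constant \<open>L\<close> for all \<open>\<sigma> x\<close> near the
  point, so the difference quotients of the maximum are bounded by
  \<open>L * \<bar>\<zeta>\<bar>\<close>. This one bound serves both the dominated convergence and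
  the fourth moments.\<close>

section \<open>Posterior covariance\<close>

text \<open>A generalised inverse of \<open>K\<close>: whenever the system with right-hand side \<open>b\<close> is solvable,
  \<open>G b\<close> solves it.\<close>

lemma linear_solution_selector:
  fixes K :: "nat \<Rightarrow> nat \<Rightarrow> real"
  assumes "finite I"
  shows "\<exists>G. \<forall>c. \<forall>j\<in>I. (\<Sum>i<n. (\<Sum>l\<in>I. G i l * (\<Sum>i<n. c i * K i l)) * K i j) = (\<Sum>i<n. c i * K i j)"
proof (induction n)
  case 0
  then show ?case by simp
next
  case (Suc n)
  then obtain G where G: "\<And>c j. j \<in> I \<Longrightarrow>
     (\<Sum>i<n. (\<Sum>l\<in>I. G i l * (\<Sum>i<n. c i * K i l)) * K i j) = (\<Sum>i<n. c i * K i j)"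
    by blast
  \<comment> \<open>\<open>g i b\<close> is the coefficient of row \<open>i\<close> that the
    selector for the first \<open>n\<close> rows assigns to the right-hand side \<open>b\<close>.
    \<open>Pr b\<close> below is the resulting combination of rows; on \<open>I\<close> it
    reproduces \<open>b\<close> whenever \<open>b\<close> lies in their span.\<close>
  define g where "g = (\<lambda>i (b::nat \<Rightarrow> real). \<Sum>l\<in>I. G i l * b l)"
  have g_add: "g i (\<lambda>l. b l + e * b' l) = g i b + e * g i b'" for i b b' e
    by (simp add: g_def algebra_simps sum.distrib sum_distrib_left)
  define Pr where "Pr = (\<lambda>b j. \<Sum>i<n. g i b * K i j)"
  have Pr_add: "Pr (\<lambda>l. b l + e * b' l) j = Pr b j + e * Pr b' j" for b b' e j
    by (simp add: Pr_def g_add algebra_simps sum.distrib sum_distrib_left)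
  have Pr_span: "Pr (\<lambda>l. \<Sum>i<n. c i * K i l) j = (\<Sum>i<n. c i * K i j)" if "j \<in> I" for c j
    using G[OF that, of c] by (simp add: Pr_def g_def)
  \<comment> \<open>\<open>u\<close> is what \<open>Pr\<close> leaves of the new row. If it vanishes
    on \<open>I\<close>, row \<open>n\<close> adds nothing to the span and gets coefficient 0;
    otherwise a nonzero entry \<open>u m\<close> serves as pivot.\<close>
  define u where "u = (\<lambda>j. K n j - Pr (K n) j)"
  show ?case
  proof (cases "\<forall>j\<in>I. u j = 0")
    case True
    show ?thesis
    proof (intro exI[of _ "\<lambda>i l. if i < n then G i l else 0"] allI ballI)
      fix c :: "nat \<Rightarrow> real" and j assume j: "j \<in> I"
      have "(\<Sum>i<Suc n. (\<Sum>l\<in>I. (if i < n then G i l else 0) * (\<Sum>i<Suc n. c i * K i l)) * K i j)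
         = Pr (\<lambda>l. (\<Sum>i<n. c i * K i l) + c n * K n l) j"
        by (simp add: Pr_def g_def)
      also have "\<dots> = (\<Sum>i<Suc n. c i * K i j)"
        using True j by (simp add: Pr_add Pr_span u_def)
      finally show "(\<Sum>i<Suc n. (\<Sum>l\<in>I. (if i < n then G i l else 0) * (\<Sum>i<Suc n. c i * K i l)) * K i j) = (\<Sum>i<Suc n. c i * K i j)" .
    qed
  next
    case False
    then obtain m where m: "m \<in> I" "u m \<noteq> 0" by blast
    \<comment> \<open>The functional with weights \<open>\<phi>\<close> vanishes on the span of the
      first \<open>n\<close> rows and equals 1 on row \<open>n\<close>, so on a solvable right-hand
      side it reads off \<open>c n\<close>.\<close>
    define \<phi> where "\<phi> = (\<lambda>l. ((if l = m then 1 else 0) - (\<Sum>i<n. G i l * K i m)) / u m)"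
    have \<phi>: "(\<Sum>l\<in>I. \<phi> l * b l) = (b m - Pr b m) / u m" for b
    proof -
      have "(\<Sum>l\<in>I. \<phi> l * b l) = (\<Sum>l\<in>I. ((if l = m then b l else 0) - (\<Sum>i<n. G i l * b l * K i m)) / u m)"
        by (intro sum.cong refl) (simp add: \<phi>_def field_simps sum_distrib_left sum_distrib_right)
      also have "\<dots> = (b m - (\<Sum>l\<in>I. \<Sum>i<n. G i l * b l * K i m)) / u m"
        using m(1) assms by (simp add: sum_divide_distrib[symmetric] sum_subtractf)
      also have "(\<Sum>l\<in>I. \<Sum>i<n. G i l * b l * K i m) = Pr b m"
        by (subst sum.swap) (simp add: Pr_def g_def sum_distrib_right)
      finally show ?thesis .
    qed
    \<comment> \<open>Row \<open>n\<close> receives the value of the functional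
      \<open>\<phi>\<close> at \<open>b\<close>; the old selector is applied to \<open>b\<close>
      minus that multiple of row \<open>n\<close>.\<close>
    define G' where "G' = (\<lambda>i l. if i < n then G i l - g i (K n) * \<phi> l else \<phi> l)"
    show ?thesis
    proof (intro exI[of _ G'] allI ballI)
      fix c :: "nat \<Rightarrow> real" and j assume j: "j \<in> I"
      define b0 where "b0 = (\<lambda>l. \<Sum>i<n. c i * K i l)"
      define b where "b = (\<lambda>l. b0 l + c n * K n l)"
      have fb: "(\<Sum>l\<in>I. \<phi> l * b l) = c n"
      proof -
        have "b m - Pr b m = c n * u m"
          using Pr_span[OF m(1), of c] Pr_add[of b0 "c n" "K n" m]
          unfolding b_def b0_def u_def by (simp add: right_diff_distrib)
        then show ?thesis using m(2) by (simp only: \<phi>) simp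
      qed
      have G'b: "(\<Sum>l\<in>I. G' i l * b l) = g i b - g i (K n) * c n" if "i < n" for i
        using that by (simp add: G'_def g_def left_diff_distrib sum_subtractf mult.assoc
            sum_distrib_left[symmetric] fb)
      have "(\<Sum>i<Suc n. (\<Sum>l\<in>I. G' i l * (\<Sum>i<Suc n. c i * K i l)) * K i j)
        = (\<Sum>i<Suc n. (\<Sum>l\<in>I. G' i l * b l) * K i j)"
        by (simp add: b_def b0_def)
      also have "\<dots> = (\<Sum>i<n. (g i b - g i (K n) * c n) * K i j) + c n * K n j"
        by (simp add: G'b) (simp add: G'_def fb)
      also have "\<dots> = Pr b j - c n * Pr (K n) j + c n * K n j"
        by (simp add: Pr_def algebra_simps sum_subtractf sum_distrib_left)
      also have "\<dots> = b j"
        using Pr_span[OF j, of c] by (simp add: b_def Pr_add b0_def)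
      finally show "(\<Sum>i<Suc n. (\<Sum>l\<in>I. G' i l * (\<Sum>i<Suc n. c i * K i l)) * K i j) = (\<Sum>i<Suc n. c i * K i j)"
        by (simp add: b_def b0_def)
    qed
  qed
qed

section \<open>Moments of Gaussian variables and processes\<close>

lemma normal_law_moments:
  assumes "v \<ge> 0"
  shows "integrable (normal_law m v) (\<lambda>x. x)" "(\<integral>x. x \<partial>normal_law m v) = m"
    "integrable (normal_law m v) (\<lambda>x. x\<^sup>2)" "(\<integral>x. x\<^sup>2 \<partial>normal_law m v) = v + m\<^sup>2"
proof -
  have "integrable (normal_law m v) (\<lambda>x. x) \<and> (\<integral>x. x \<partial>normal_law m v) = m \<and>
    integrable (normal_law m v) (\<lambda>x. x\<^sup>2) \<and> (\<integral>x. x\<^sup>2 \<partial>normal_law m v) = v + m\<^sup>2"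
  proof (cases "v = 0")
    case True
    have ret: "integrable (return borel m) f" if "f \<in> borel_measurable borel" for f :: "real \<Rightarrow> real"
    proof (rule finite_measure.integrable_const_bound[where B="norm (f m)"])
      show "finite_measure (return borel m)"
        by (intro prob_space.finite_measure prob_space_return) simp
      show "AE x in return borel m. norm (f x) \<le> norm (f m)"
        using that by (subst AE_return) simp_all
      show "f \<in> borel_measurable (return borel m)"
        using that by simp
    qed
    have "integrable (return borel m) (\<lambda>x::real. x)" "integrable (return borel m) (\<lambda>x::real. x\<^sup>2)"
      by (rule ret; measurable)+
    moreover have "(\<integral>x. x \<partial>return borel m) = m" "(\<integral>x. x\<^sup>2 \<partial>return borel m) = m\<^sup>2"
      by (rule integral_return; simp)+
    ultimately show ?thesis using True by (simp only: normal_law_def if_True refl) simp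
  next
    case False
    then have s: "sqrt v > 0" using assms by simp
    let ?d = "normal_density m (sqrt v)"
    have i1: "has_bochner_integral lborel (\<lambda>x. ?d x * x) m"
      by (rule normal_moment_nz_1[OF s])
    have i0: "has_bochner_integral lborel ?d 1"
      using normal_moment_even[OF s, of m 0] by simp
    have i2: "has_bochner_integral lborel (\<lambda>x. ?d x * (x - m)^2) v"
    proof -
      have "fact (2 * 1) / ((2 / (sqrt v)\<^sup>2) ^ 1 * fact 1) = v"
        using assms False by (simp add: fact_numeral)
      with normal_moment_even[OF s, of m 1] show ?thesis by (simp only: mult_1_right)
    qed
    \<comment> \<open>This uses
      \<open>x\<^sup>2 = (x - m)\<^sup>2 + 2 * m * x - m\<^sup>2\<close>.\<close>
    have "has_bochner_integral lborel (\<lambda>x. ?d x * (x - m)^2 + 2 * m * (?d x * x) - m\<^sup>2 * ?d x)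
       (v + 2 * m * m - m\<^sup>2 * 1)"
      by (intro has_bochner_integral_add has_bochner_integral_diff has_bochner_integral_mult_right i0 i1 i2)
    then have i3: "has_bochner_integral lborel (\<lambda>x. ?d x * x\<^sup>2) (v + m\<^sup>2)"
      by (simp add: power2_eq_square algebra_simps)
    show ?thesis
      using i1 i3 False
      by (simp add: normal_law_def integrable_density integral_density has_bochner_integral_iff)
  qed
  then show "integrable (normal_law m v) (\<lambda>x. x)" "(\<integral>x. x \<partial>normal_law m v) = m"
    "integrable (normal_law m v) (\<lambda>x. x\<^sup>2)" "(\<integral>x. x\<^sup>2 \<partial>normal_law m v) = v + m\<^sup>2" by auto
qed

lemma distr_normal_law_moments:
  fixes X :: "'s \<Rightarrow> real"
  assumes X: "X \<in> borel_measurable M" and d: "distr M borel X = normal_law m v" and v: "v \<ge> 0"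
  shows "integrable M X" "(\<integral>\<omega>. X \<omega> \<partial>M) = m"
    "integrable M (\<lambda>\<omega>. (X \<omega>)\<^sup>2)" "(\<integral>\<omega>. (X \<omega>)\<^sup>2 \<partial>M) = v + m\<^sup>2"
  using normal_law_moments[OF v, of m] unfolding d[symmetric]
  by (simp_all add: integrable_distr_eq[OF X] integral_distr[OF X])

lemma integrable_mult_of_squares:
  fixes X Y :: "'s \<Rightarrow> real"
  assumes "X \<in> borel_measurable M" "Y \<in> borel_measurable M"
    "integrable M (\<lambda>\<omega>. (X \<omega>)\<^sup>2)" "integrable M (\<lambda>\<omega>. (Y \<omega>)\<^sup>2)"
  shows "integrable M (\<lambda>\<omega>. X \<omega> * Y \<omega>)"
proof (rule Bochner_Integration.integrable_bound)
  show "integrable M (\<lambda>\<omega>. (X \<omega>)\<^sup>2 + (Y \<omega>)\<^sup>2)" using assms by simp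
  show "AE \<omega> in M. norm (X \<omega> * Y \<omega>) \<le> norm ((X \<omega>)\<^sup>2 + (Y \<omega>)\<^sup>2)"
  proof (rule AE_I2)
    fix \<omega>
    have "2 * (\<bar>X \<omega>\<bar> * \<bar>Y \<omega>\<bar>) \<le> (X \<omega>)\<^sup>2 + (Y \<omega>)\<^sup>2"
      using sum_squares_bound[of "\<bar>X \<omega>\<bar>" "\<bar>Y \<omega>\<bar>"] by (simp add: mult.assoc)
    moreover have "0 \<le> \<bar>X \<omega>\<bar> * \<bar>Y \<omega>\<bar>" by (intro mult_nonneg_nonneg abs_ge_zero)
    ultimately have "\<bar>X \<omega>\<bar> * \<bar>Y \<omega>\<bar> \<le> (X \<omega>)\<^sup>2 + (Y \<omega>)\<^sup>2" by linarith
    then show "norm (X \<omega> * Y \<omega>) \<le> norm ((X \<omega>)\<^sup>2 + (Y \<omega>)\<^sup>2)"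
      by (simp add: abs_mult)
  qed
qed (use assms in simp)

text \<open>\<open>gaussian_process\<close> fixes only the laws of linear combinations, so the
  product moment is obtained by polarisation from the second moment of \<open>F s + F t\<close>. The
  case \<open>s = t\<close> is separate because \<open>{s, t}\<close> then collapses to one
  index.\<close>

lemma gaussian_process_moments:
  assumes gp: "gaussian_process M T F m k" and s: "s \<in> T" and t: "t \<in> T"
  shows "F t \<in> borel_measurable M" "integrable M (F t)" "(\<integral>\<omega>. F t \<omega> \<partial>M) = m t"
    "integrable M (\<lambda>\<omega>. (F t \<omega>)\<^sup>2)"
    "integrable M (\<lambda>\<omega>. F s \<omega> * F t \<omega>)" "(\<integral>\<omega>. F s \<omega> * F t \<omega> \<partial>M) = k s t + m s * m t"
proof -
  have meas: "F u \<in> borel_measurable M" if "u \<in> T" for u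
    using gp that by (auto simp: gaussian_process_def)
  have sym: "k s t = k t s" using gp s t by (auto simp: gaussian_process_def)
  have law: "0 \<le> (\<Sum>s\<in>J. \<Sum>t\<in>J. c s * c t * k s t)"
      "distr M borel (\<lambda>\<omega>. \<Sum>t\<in>J. c t * F t \<omega>) =
          normal_law (\<Sum>t\<in>J. c t * m t) (\<Sum>s\<in>J. \<Sum>t\<in>J. c s * c t * k s t)"
    if "finite J" "J \<subseteq> T" for J c
    using gp that by (auto simp: gaussian_process_def)
  have one: "integrable M (F u) \<and> (\<integral>\<omega>. F u \<omega> \<partial>M) = m u \<and> integrable M (\<lambda>\<omega>. (F u \<omega>)\<^sup>2)
     \<and> (\<integral>\<omega>. (F u \<omega>)\<^sup>2 \<partial>M) = k u u + (m u)\<^sup>2" if "u \<in> T" for u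
    using distr_normal_law_moments[OF meas[OF that], of "m u" "k u u"] law[of "{u}" "\<lambda>_. 1"] that
    by simp
  show "F t \<in> borel_measurable M" "integrable M (F t)" "(\<integral>\<omega>. F t \<omega> \<partial>M) = m t"
    "integrable M (\<lambda>\<omega>. (F t \<omega>)\<^sup>2)" using meas one t by auto
  show i: "integrable M (\<lambda>\<omega>. F s \<omega> * F t \<omega>)"
    using meas one s t by (intro integrable_mult_of_squares) auto
  show "(\<integral>\<omega>. F s \<omega> * F t \<omega> \<partial>M) = k s t + m s * m t"
  proof (cases "s = t")
    case True
    then show ?thesis using one[OF t] by (simp add: power2_eq_square)
  next
    case False
    have "(\<integral>\<omega>. (F s \<omega> + F t \<omega>)\<^sup>2 \<partial>M) = (k s s + k s t + (k t s + k t t)) + (m s + m t)\<^sup>2"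
      using distr_normal_law_moments(4)[of "\<lambda>\<omega>. F s \<omega> + F t \<omega>" M "m s + m t" "k s s + k s t + (k t s + k t t)"]
        law[of "{s,t}" "\<lambda>_. 1"] s t False meas by simp
    moreover have "(\<integral>\<omega>. (F s \<omega> + F t \<omega>)\<^sup>2 \<partial>M) = (\<integral>\<omega>. (F s \<omega>)\<^sup>2 + (F t \<omega>)\<^sup>2 + 2 * (F s \<omega> * F t \<omega>) \<partial>M)"
      by (simp add: power2_sum algebra_simps)
    moreover have "\<dots> = (k s s + (m s)\<^sup>2) + (k t t + (m t)\<^sup>2) + 2 * (\<integral>\<omega>. F s \<omega> * F t \<omega> \<partial>M)"
      using one[OF s] one[OF t] i by simp
    ultimately show ?thesis using sym by (simp add: power2_sum algebra_simps)
  qed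
qed

section \<open>Generated sigma-algebras and independence\<close>

lemma measurable_generated_algebra:
  assumes "i \<in> I" "X i \<in> borel_measurable M"
  shows "X i \<in> borel_measurable (generated_algebra M I X)"
proof (rule measurableI)
  fix B :: "real set" assume "B \<in> sets borel"
  then show "X i -` B \<inter> space (generated_algebra M I X) \<in> sets (generated_algebra M I X)"
    using assms(1) unfolding generated_algebra_def
    by (subst sets_measure_of) (auto intro!: sigma_sets.Basic simp: space_measure_of_conv)
qed simp

lemma subalgebra_generated_algebra:
  assumes "\<And>i. i \<in> I \<Longrightarrow> X i \<in> borel_measurable M"
  shows "subalgebra M (generated_algebra M I X)"
proof -
  have "sigma_sets (space M) {X i -` B \<inter> space M |i B. i \<in> I \<and> B \<in> sets borel} \<subseteq> sets M"
    using assms by (intro sets.sigma_sets_subset) (auto intro: measurable_sets)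
  then show ?thesis
    unfolding subalgebra_def generated_algebra_def
    by (subst sets_measure_of) (auto simp: space_measure_of_conv)
qed

text \<open>Passes from independence of sigma-algebras, as in \<open>observation_noise\<close>, to
  independence of one process value and one noise variable, which is what makes their product have
  mean zero.\<close>

lemma (in prob_space) indep_var_of_indep_set:
  fixes X Y :: "'a \<Rightarrow> real"
  assumes "indep_set (sets G) (sets H)" "X \<in> borel_measurable G" "Y \<in> borel_measurable H"
    and G: "subalgebra M G" and H: "subalgebra M H"
  shows "indep_var borel X borel Y"
proof -
  have X: "X \<in> borel_measurable M" and Y: "Y \<in> borel_measurable M"
    using assms by (auto intro: measurable_from_subalg)
  have "{X -` A \<inter> space M | A. A \<in> sets borel} \<subseteq> sets G"
    using measurable_sets[OF assms(2)] G by (auto simp: subalgebra_def)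
  then have 1: "sigma_sets (space M) {X -` A \<inter> space M | A. A \<in> sets borel} \<subseteq> sets G"
    using sets.sigma_sets_subset[of _ G] G by (auto simp: subalgebra_def)
  have "{Y -` A \<inter> space M | A. A \<in> sets borel} \<subseteq> sets H"
    using measurable_sets[OF assms(3)] H by (auto simp: subalgebra_def)
  then have 2: "sigma_sets (space M) {Y -` A \<inter> space M | A. A \<in> sets borel} \<subseteq> sets H"
    using sets.sigma_sets_subset[of _ H] H by (auto simp: subalgebra_def)
  have "indep_sets (case_bool (sigma_sets (space M) {X -` A \<inter> space M | A. A \<in> sets borel})
      (sigma_sets (space M) {Y -` A \<inter> space M | A. A \<in> sets borel})) UNIV"
    by (rule indep_sets_mono_sets[OF assms(1)[unfolded indep_set_def]]) (use 1 2 in \<open>auto split: bool.split\<close>)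
  then show ?thesis
    using X Y unfolding indep_var_eq indep_set_def by simp
qed


text \<open>\<open>c\<close> is the vector of regression coefficients of \<open>F t\<close> on the
  observations, taken from the affine version of the conditional expectation that
  \<open>posterior\<close> provides. Testing the residual of \<open>F t\<close> against the
  observations gives the linear system; testing it against \<open>F s\<close> gives the
  covariance.\<close>

lemma posterior_normal_equations:
  assumes M: "prob_space M" and gp: "gaussian_process M T F m k"
    and pt: "\<And>i. i < n \<Longrightarrow> pt i \<in> T" and lam: "\<And>t. t \<in> T \<Longrightarrow> lam t \<ge> 0"
    and noise: "observation_noise M T F n pt lam \<epsilon>"
    and post: "posterior M T F n (\<lambda>i \<omega>. F (pt i) \<omega> + \<epsilon> i \<omega>) yobs \<mu> K"
    and t: "t \<in> T"
  shows "\<exists>c. (\<forall>j<n. k t (pt j) = (\<Sum>i<n. c i * (k (pt i) (pt j) + (if i = j then lam (pt i) else 0)))) \<and>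
             (\<forall>s\<in>T. K t s = k t s - (\<Sum>i<n. c i * k (pt i) s))"
proof -
  interpret prob_space M by fact
  note gpm = gaussian_process_moments[OF gp]
  define Y where "Y = (\<lambda>i \<omega>. F (pt i) \<omega> + \<epsilon> i \<omega>)"
  define G where "G = generated_algebra M {..<n} Y"
  define E where "E = real_cond_exp M G"
  have Fm[measurable]: "F s \<in> borel_measurable M" if "s \<in> T" for s using gpm(1)[OF that that] .
  have em: "\<epsilon> i \<in> borel_measurable M" if "i < n" for i
    using noise that by (auto simp: observation_noise_def indep_vars_def)
  have edist: "distr M borel (\<epsilon> i) = normal_law 0 (lam (pt i))" if "i < n" for i
    using noise that by (auto simp: observation_noise_def)
  note emom = distr_normal_law_moments[OF em edist lam[OF pt]]
  have Fe: "indep_var borel (F s) borel (\<epsilon> i)" if "s \<in> T" "i < n" for s i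
  proof (rule indep_var_of_indep_set)
    show "indep_set (sets (generated_algebra M T F)) (sets (generated_algebra M {..<n} \<epsilon>))"
      using noise by (auto simp: observation_noise_def)
  qed (use that Fm em in \<open>auto intro!: measurable_generated_algebra subalgebra_generated_algebra\<close>)
  have Fe0: "integrable M (\<lambda>\<omega>. F s \<omega> * \<epsilon> i \<omega>)" "(\<integral>\<omega>. F s \<omega> * \<epsilon> i \<omega> \<partial>M) = 0" if "s \<in> T" "i < n" for s i
    using indep_var_integrable[OF Fe[OF that]] indep_var_lebesgue_integral[OF Fe[OF that]]
      gpm(2)[OF that(1,1)] emom(1,2)[OF that(2) that(2) that(2)] by auto
  have ee0: "integrable M (\<lambda>\<omega>. \<epsilon> i \<omega> * \<epsilon> j \<omega>)"
     "(\<integral>\<omega>. \<epsilon> i \<omega> * \<epsilon> j \<omega> \<partial>M) = (if i = j then lam (pt i) else 0)" if "i < n" "j < n" for i j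
  proof -
    show "integrable M (\<lambda>\<omega>. \<epsilon> i \<omega> * \<epsilon> j \<omega>)"
      using that em emom(3) by (intro integrable_mult_of_squares) auto
    show "(\<integral>\<omega>. \<epsilon> i \<omega> * \<epsilon> j \<omega> \<partial>M) = (if i = j then lam (pt i) else 0)"
    proof (cases "i = j")
      case True
      then show ?thesis using emom(4)[OF that(1) that(1) that(1)] by (simp add: power2_eq_square)
    next
      case False
      have "indep_vars (\<lambda>_. borel) \<epsilon> {i, j}"
        using noise that by (auto simp: observation_noise_def intro: indep_vars_subset)
      then show ?thesis
        using indep_vars_lebesgue_integral[of "{i, j}" \<epsilon>] emom(1,2) that False by auto
    qed
  qed
  have LC: "integrable M (\<lambda>\<omega>. \<Sum>i<n. d i * X i \<omega>)"
      "(\<integral>\<omega>. (\<Sum>i<n. d i * X i \<omega>) \<partial>M) = (\<Sum>i<n. d i * (\<integral>\<omega>. X i \<omega> \<partial>M))"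
    if "\<And>i. i < n \<Longrightarrow> integrable M (X i)" for d and X :: "nat \<Rightarrow> _ \<Rightarrow> real"
    using that by (auto intro!: integrable_sum integrable_mult_right simp: integral_sum)
  have Ym[measurable]: "Y i \<in> borel_measurable M" if "i < n" for i
    unfolding Y_def using that Fm[OF pt] em by simp
  have EY: "integrable M (Y i)" "(\<integral>\<omega>. Y i \<omega> \<partial>M) = m (pt i)" if "i < n" for i
    using that gpm(2,3)[OF pt pt] emom(1,2) by (simp_all add: Y_def)
  have FY: "integrable M (\<lambda>\<omega>. F s \<omega> * Y i \<omega>)"
     "(\<integral>\<omega>. F s \<omega> * Y i \<omega> \<partial>M) = k s (pt i) + m s * m (pt i)" if "s \<in> T" "i < n" for s i
    using gpm(5,6)[OF that(1) pt[OF that(2)]] Fe0[OF that] by (simp_all add: Y_def distrib_left)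
  have YY: "integrable M (\<lambda>\<omega>. Y i \<omega> * Y j \<omega>)"
     "(\<integral>\<omega>. Y i \<omega> * Y j \<omega> \<partial>M) = k (pt i) (pt j) + (if i = j then lam (pt i) else 0) + m (pt i) * m (pt j)"
     if "i < n" "j < n" for i j
  proof -
    have 1: "(\<lambda>\<omega>. Y i \<omega> * Y j \<omega>) = (\<lambda>\<omega>. F (pt i) \<omega> * Y j \<omega> + (F (pt j) \<omega> * \<epsilon> i \<omega> + \<epsilon> i \<omega> * \<epsilon> j \<omega>))"
      by (simp add: Y_def algebra_simps)
    note 2 = FY[OF pt[OF that(1)] that(2)] Fe0[OF pt[OF that(2)] that(1)] ee0[OF that]
    show "integrable M (\<lambda>\<omega>. Y i \<omega> * Y j \<omega>)" unfolding 1 using 2 by simp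
    show "(\<integral>\<omega>. Y i \<omega> * Y j \<omega> \<partial>M) = k (pt i) (pt j) + (if i = j then lam (pt i) else 0) + m (pt i) * m (pt j)"
      unfolding 1 using 2 by simp
  qed
  have subalg: "subalgebra M G" unfolding G_def using Ym by (intro subalgebra_generated_algebra) auto
  interpret sub: finite_measure_subalgebra M G by unfold_locales fact
  have YG: "Y i \<in> borel_measurable G" if "i < n" for i
    unfolding G_def using that Ym by (intro measurable_generated_algebra) auto
  have aff: "\<exists>b c. AE \<omega> in M. E (F s) \<omega> = b + (\<Sum>i<n. c i * Y i \<omega>)" if "s \<in> T" for s
    using post that unfolding posterior_def Let_def E_def G_def Y_def by blast
  have Kae: "AE \<omega> in M. E (\<lambda>\<omega>'. (F s \<omega>' - E (F s) \<omega>') * (F u \<omega>' - E (F u) \<omega>')) \<omega> = K s u"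
    if "s \<in> T" "u \<in> T" for s u
    using post that unfolding posterior_def Let_def E_def G_def Y_def by blast
  obtain b c where bc: "AE \<omega> in M. E (F t) \<omega> = b + (\<Sum>i<n. c i * Y i \<omega>)" using aff[OF t] by blast
  \<comment> \<open>\<open>R\<close> is the residual in a version explicitly affine in the
    observations; \<open>F t - E (F t)\<close> agrees with it almost surely.\<close>
  define R where "R = (\<lambda>\<omega>. F t \<omega> - (b + (\<Sum>i<n. c i * Y i \<omega>)))"
  have Rm[measurable]: "R \<in> borel_measurable M" unfolding R_def using t Ym by (auto intro!: borel_measurable_diff borel_measurable_sum borel_measurable_times Fm)
  have Emt: "E s \<in> borel_measurable M" for s unfolding E_def by simp
  have R1: "(\<integral>\<omega>. R \<omega> \<partial>M) = m t - b - (\<Sum>i<n. c i * m (pt i))"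
  proof -
    have "integrable M (\<lambda>\<omega>. \<Sum>i<n. c i * Y i \<omega>)" "(\<integral>\<omega>. (\<Sum>i<n. c i * Y i \<omega>) \<partial>M) = (\<Sum>i<n. c i * m (pt i))"
      using LC[of Y c] EY by simp_all
    then show ?thesis
      unfolding R_def using gpm(2,3)[OF t t] by (simp add: prob_space)
  qed
  have RX: "(\<integral>\<omega>. R \<omega> * X \<omega> \<partial>M) = (\<integral>\<omega>. F t \<omega> * X \<omega> \<partial>M) - b * (\<integral>\<omega>. X \<omega> \<partial>M) - (\<Sum>i<n. c i * (\<integral>\<omega>. Y i \<omega> * X \<omega> \<partial>M))"
      and RXi: "integrable M (\<lambda>\<omega>. R \<omega> * X \<omega>)"
    if "integrable M X" "integrable M (\<lambda>\<omega>. F t \<omega> * X \<omega>)" "\<And>i. i < n \<Longrightarrow> integrable M (\<lambda>\<omega>. Y i \<omega> * X \<omega>)" for X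
  proof -
    have 1: "(\<lambda>\<omega>. R \<omega> * X \<omega>) = (\<lambda>\<omega>. F t \<omega> * X \<omega> - b * X \<omega> - (\<Sum>i<n. c i * (Y i \<omega> * X \<omega>)))"
      by (simp add: R_def algebra_simps sum_distrib_left)
    show "integrable M (\<lambda>\<omega>. R \<omega> * X \<omega>)" unfolding 1 using that LC[of "\<lambda>i \<omega>. Y i \<omega> * X \<omega>" c] by simp
    show "(\<integral>\<omega>. R \<omega> * X \<omega> \<partial>M) = (\<integral>\<omega>. F t \<omega> * X \<omega> \<partial>M) - b * (\<integral>\<omega>. X \<omega> \<partial>M) - (\<Sum>i<n. c i * (\<integral>\<omega>. Y i \<omega> * X \<omega> \<partial>M))"
      unfolding 1 using that LC[of "\<lambda>i \<omega>. Y i \<omega> * X \<omega>" c] by simp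
  qed
  have mean0: "m t = b + (\<Sum>i<n. c i * m (pt i))"
  proof -
    have "(\<integral>\<omega>. F t \<omega> \<partial>M) = (\<integral>\<omega>. E (F t) \<omega> \<partial>M)"
      unfolding E_def using sub.real_cond_exp_int(2)[OF gpm(2)[OF t t]] by simp
    also have "\<dots> = (\<integral>\<omega>. b + (\<Sum>i<n. c i * Y i \<omega>) \<partial>M)"
      using bc by (intro integral_cong_AE) (auto intro!: borel_measurable_add borel_measurable_sum borel_measurable_times Ym Emt)
    also have "\<dots> = b + (\<Sum>i<n. c i * m (pt i))" using EY LC[of Y c] by (simp add: prob_space)
    finally show ?thesis using gpm(3)[OF t t] by simp
  qed
  have orth: "(\<integral>\<omega>. R \<omega> * Y j \<omega> \<partial>M) = 0" "integrable M (\<lambda>\<omega>. R \<omega> * Y j \<omega>)" if "j < n" for j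
  proof -
    have i: "integrable M (\<lambda>\<omega>. Y j \<omega> * F t \<omega>)" using FY(1)[OF t that] by (simp add: mult.commute)
    \<comment> \<open>\<open>Y j\<close> is measurable for the conditioning sigma-algebra
      \<open>G\<close>, so \<open>F t\<close> may be replaced by its conditional expectation under
      the integral.\<close>
    have "(\<integral>\<omega>. Y j \<omega> * F t \<omega> \<partial>M) = (\<integral>\<omega>. Y j \<omega> * E (F t) \<omega> \<partial>M)"
      unfolding E_def using sub.real_cond_exp_intg(2)[OF i YG[OF that] Fm[OF t]] by simp
    also have "\<dots> = (\<integral>\<omega>. Y j \<omega> * (b + (\<Sum>i<n. c i * Y i \<omega>)) \<partial>M)"
      using bc that by (intro integral_cong_AE) (auto intro!: borel_measurable_add borel_measurable_sum borel_measurable_times Ym Emt)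
    finally have "(\<integral>\<omega>. Y j \<omega> * F t \<omega> \<partial>M) = (\<integral>\<omega>. Y j \<omega> * (b + (\<Sum>i<n. c i * Y i \<omega>)) \<partial>M)" .
    moreover have "integrable M (\<lambda>\<omega>. Y j \<omega> * (b + (\<Sum>i<n. c i * Y i \<omega>)))"
    proof -
      have 1: "(\<lambda>\<omega>. Y j \<omega> * (b + (\<Sum>i<n. c i * Y i \<omega>))) = (\<lambda>\<omega>. b * Y j \<omega> + (\<Sum>i<n. c i * (Y i \<omega> * Y j \<omega>)))"
        by (simp add: algebra_simps sum_distrib_left)
      show ?thesis unfolding 1 using EY that YY LC[of "\<lambda>i \<omega>. Y i \<omega> * Y j \<omega>" c] by simp
    qed
    moreover have 2: "(\<lambda>\<omega>. R \<omega> * Y j \<omega>) = (\<lambda>\<omega>. Y j \<omega> * F t \<omega> - Y j \<omega> * (b + (\<Sum>i<n. c i * Y i \<omega>)))"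
      by (simp add: R_def left_diff_distrib right_diff_distrib mult.commute)
    ultimately show "(\<integral>\<omega>. R \<omega> * Y j \<omega> \<partial>M) = 0" "integrable M (\<lambda>\<omega>. R \<omega> * Y j \<omega>)"
      using i unfolding 2 by simp_all
  qed
  have "k t (pt j) = (\<Sum>i<n. c i * (k (pt i) (pt j) + (if i = j then lam (pt i) else 0)))" if "j < n" for j
  proof -
    have "0 = (k t (pt j) + m t * m (pt j)) - b * m (pt j)
        - (\<Sum>i<n. c i * (k (pt i) (pt j) + (if i = j then lam (pt i) else 0) + m (pt i) * m (pt j)))"
      using RX[of "Y j"] orth[OF that] FY[OF t that] EY[OF that] YY[OF _ that] by simp
    also have "\<dots> = k t (pt j) + (m t - b - (\<Sum>i<n. c i * m (pt i))) * m (pt j)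
        - (\<Sum>i<n. c i * (k (pt i) (pt j) + (if i = j then lam (pt i) else 0)))"
      by (simp add: distrib_left sum.distrib left_diff_distrib sum_distrib_right mult.assoc)
    finally show ?thesis using mean0 by simp
  qed
  moreover have "K t s = k t s - (\<Sum>i<n. c i * k (pt i) s)" if s: "s \<in> T" for s
  proof -
    obtain b' c' where bc': "AE \<omega> in M. E (F s) \<omega> = b' + (\<Sum>i<n. c' i * Y i \<omega>)" using aff[OF s] by blast
    let ?Q = "\<lambda>\<omega>. R \<omega> * (F s \<omega> - (b' + (\<Sum>i<n. c' i * Y i \<omega>)))"
    let ?P = "\<lambda>\<omega>. (F t \<omega> - E (F t) \<omega>) * (F s \<omega> - E (F s) \<omega>)"
    have Q: "?Q = (\<lambda>\<omega>. R \<omega> * F s \<omega> - b' * R \<omega> - (\<Sum>i<n. c' i * (R \<omega> * Y i \<omega>)))"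
      by (simp add: algebra_simps sum_distrib_left)
    have RF: "integrable M (\<lambda>\<omega>. R \<omega> * F s \<omega>)"
      "(\<integral>\<omega>. R \<omega> * F s \<omega> \<partial>M) = (k t s + m t * m s) - b * m s - (\<Sum>i<n. c i * (k s (pt i) + m s * m (pt i)))"
      using RX[of "F s"] RXi[of "F s"] gpm(5,6)[OF t s] gpm(2,3)[OF s s] FY[OF s]
      by (simp_all add: mult.commute)
    have Ri: "integrable M R" unfolding R_def using gpm(2)[OF t t] EY LC[of Y c] by simp
    have Qi: "integrable M ?Q" unfolding Q using RF Ri orth LC[of "\<lambda>i \<omega>. R \<omega> * Y i \<omega>" c'] by simp
    have AEQ: "AE \<omega> in M. ?P \<omega> = ?Q \<omega>" using bc bc' by eventually_elim (simp add: R_def)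
    have Pm: "?P \<in> borel_measurable M" using Emt Fm t s by (intro borel_measurable_times borel_measurable_diff) auto
    have Pi: "integrable M ?P" using integrable_cong_AE[OF Pm _ AEQ] Qi by auto
    \<comment> \<open>The conditional covariance is almost surely the constant \<open>K t s\<close>,
      so it equals its own expectation, an ordinary covariance of residuals.\<close>
    have "K t s = (\<integral>\<omega>. K t s \<partial>M)" by (simp add: prob_space)
    also have "\<dots> = (\<integral>\<omega>. E ?P \<omega> \<partial>M)"
      using Kae[OF t s] Emt by (intro integral_cong_AE) auto
    also have "\<dots> = (\<integral>\<omega>. ?P \<omega> \<partial>M)" unfolding E_def
      using sub.real_cond_exp_int(2)[OF Pi] unfolding E_def .
    also have "\<dots> = (\<integral>\<omega>. ?Q \<omega> \<partial>M)" using AEQ Pm Qi by (intro integral_cong_AE) auto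
    \<comment> \<open>Orthogonality of \<open>R\<close> to every \<open>Y i\<close> removes the
      regression part of \<open>F s\<close>; the \<open>b'\<close> term disappears in the next step
      because \<open>R\<close> has mean zero.\<close>
    also have "\<dots> = (\<integral>\<omega>. R \<omega> * F s \<omega> \<partial>M) - b' * (\<integral>\<omega>. R \<omega> \<partial>M)"
      unfolding Q using RF Ri orth LC[of "\<lambda>i \<omega>. R \<omega> * Y i \<omega>" c'] by simp
    also have "\<dots> = k t s + (m t - b - (\<Sum>i<n. c i * m (pt i))) * m s - (\<Sum>i<n. c i * k s (pt i))"
      using mean0 unfolding R1 RF by (simp add: algebra_simps sum.distrib sum_distrib_left)
    also have "\<dots> = k t s - (\<Sum>i<n. c i * k (pt i) s)"
    proof -
      have "k s (pt i) = k (pt i) s" if "i < n" for i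
        using gp s pt[OF that] by (auto simp: gaussian_process_def)
      then show ?thesis using mean0 by simp
    qed
    finally show ?thesis .
  qed
  ultimately show ?thesis by blast
qed

text \<open>\<open>G\<close> stands in for the inverse of the covariance matrix \<open>C\<close> of
  the observations. It depends on neither \<open>s\<close> nor \<open>t\<close>, so regularity of
  \<open>k\<close> in either argument carries over to \<open>K\<close>. The second claim expresses
  that a noise-free observation leaves no uncertainty at its own point.\<close>

lemma posterior_covariance:
  assumes "prob_space M" and gp: "gaussian_process M T F m k"
    and pt: "\<And>i. i < n \<Longrightarrow> pt i \<in> T" and "\<And>t. t \<in> T \<Longrightarrow> lam t \<ge> 0"
    and "observation_noise M T F n pt lam \<epsilon>"
    and "posterior M T F n (\<lambda>i \<omega>. F (pt i) \<omega> + \<epsilon> i \<omega>) yobs \<mu> K"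
  shows "\<exists>G. \<forall>s\<in>T. \<forall>t\<in>T. K s t = k s t - (\<Sum>i<n. \<Sum>j<n. G i j * (k t (pt j) * k s (pt i)))"
    and "i < n \<Longrightarrow> lam (pt i) = 0 \<Longrightarrow> K (pt i) (pt i) = 0"
proof -
  define C where "C = (\<lambda>i j. k (pt i) (pt j) + (if i = j then lam (pt i) else 0))"
  have sym: "k s t = k t s" if "s \<in> T" "t \<in> T" for s t
    using gp that by (auto simp: gaussian_process_def)
  have C_sym: "C i j = C j i" if "i < n" "j < n" for i j
    using sym[OF pt[OF that(1)] pt[OF that(2)]] by (simp add: C_def)
  have "\<exists>c. \<forall>t\<in>T. (\<forall>j<n. k t (pt j) = (\<Sum>i<n. c t i * C i j)) \<and>
      (\<forall>s\<in>T. K t s = k t s - (\<Sum>i<n. c t i * k (pt i) s))"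
    unfolding C_def by (intro bchoice ballI posterior_normal_equations[OF assms])
  then obtain c where c: "\<And>t j. t \<in> T \<Longrightarrow> j < n \<Longrightarrow> k t (pt j) = (\<Sum>i<n. c t i * C i j)"
    "\<And>s t. t \<in> T \<Longrightarrow> s \<in> T \<Longrightarrow> K t s = k t s - (\<Sum>i<n. c t i * k (pt i) s)"
    by auto
  text \<open>Any solution of the normal equations for \<open>t\<close> gives the same posterior covariance, so a
    solution depending linearly on the right-hand side may be used.\<close>
  have *: "K s t = k s t - (\<Sum>l<n. d l * k s (pt l))"
    if s: "s \<in> T" and t: "t \<in> T" and d: "\<And>j. j < n \<Longrightarrow> k t (pt j) = (\<Sum>i<n. d i * C i j)" for s t d
  proof -
    \<comment> \<open>Because \<open>C\<close> is symmetric, both end expressions equal its bilinear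
      form at \<open>c s\<close> and \<open>d\<close>.\<close>
    have "(\<Sum>i<n. c s i * k (pt i) t) = (\<Sum>i<n. c s i * (\<Sum>l<n. d l * C l i))"
      using d t pt sym by (intro sum.cong) auto
    also have "\<dots> = (\<Sum>i<n. \<Sum>l<n. d l * (c s i * C i l))"
      using C_sym by (auto intro!: sum.cong simp: sum_distrib_left)
    also have "\<dots> = (\<Sum>l<n. d l * (\<Sum>i<n. c s i * C i l))"
      by (subst sum.swap) (simp add: sum_distrib_left)
    also have "\<dots> = (\<Sum>l<n. d l * k s (pt l))" using c(1)[OF s] by (intro sum.cong) auto
    finally show ?thesis using c(2)[OF s t] by simp
  qed
  obtain G where G: "\<And>c j. j < n \<Longrightarrow>
      (\<Sum>i<n. (\<Sum>l<n. G i l * (\<Sum>i<n. c i * C i l)) * C i j) = (\<Sum>i<n. c i * C i j)"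
    using linear_solution_selector[of "{..<n}" C n] by auto
  have "K s t = k s t - (\<Sum>i<n. \<Sum>j<n. G i j * (k t (pt j) * k s (pt i)))" if s: "s \<in> T" and t: "t \<in> T" for s t
  proof -
    have "k t (pt j) = (\<Sum>i<n. (\<Sum>l<n. G i l * k t (pt l)) * C i j)" if "j < n" for j
      using G[OF that, of "c t"] c(1)[OF t] that by simp
    from *[OF s t, of "\<lambda>i. \<Sum>l<n. G i l * k t (pt l)", OF this] show ?thesis
      by (simp add: sum_distrib_right mult.assoc)
  qed
  then show "\<exists>G. \<forall>s\<in>T. \<forall>t\<in>T. K s t = k s t - (\<Sum>i<n. \<Sum>j<n. G i j * (k t (pt j) * k s (pt i)))"
    by blast
  show "K (pt i) (pt i) = 0" if i: "i < n" and l: "lam (pt i) = 0"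
  proof -
    have delta: "(\<Sum>l<n. (if l = i then 1 else 0) * f l) = f i" for f :: "nat \<Rightarrow> real"
    proof -
      have "(\<Sum>l<n. (if l = i then 1 else 0) * f l) = (\<Sum>l<n. if l = i then f l else 0)"
        by (intro sum.cong) auto
      then show ?thesis using i by simp
    qed
    \<comment> \<open>Without noise at \<open>pt i\<close>, row \<open>i\<close> of \<open>C\<close>
      is the prior covariance with \<open>pt i\<close>, so the unit vector at \<open>i\<close>
      solves the normal equations for \<open>pt i\<close>.\<close>
    then have "k (pt i) (pt j) = (\<Sum>l<n. (if l = i then 1 else 0) * C l j)" for j
      using l by (auto simp: C_def)
    from *[OF pt[OF i] pt[OF i], of "\<lambda>l. if l = i then 1 else 0", OF this]
    show ?thesis by (simp add: delta)
  qed
qed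

section \<open>Strong law under bounded fourth moments\<close>

lemma power_le_one_plus_power4:
  fixes x :: real
  assumes "k \<le> 4"
  shows "\<bar>x\<bar> ^ k \<le> 1 + x ^ 4"
proof (cases "\<bar>x\<bar> \<le> 1")
  case True
  then have "\<bar>x\<bar> ^ k \<le> 1" by (simp add: power_le_one)
  moreover have "0 \<le> x ^ 4" by simp
  ultimately show ?thesis by linarith
next
  case False
  then have "\<bar>x\<bar> ^ k \<le> \<bar>x\<bar> ^ 4" using assms by (intro power_increasing) auto
  then show ?thesis by simp
qed

lemma (in prob_space) integrable_power_of_power4:
  fixes X :: "'a \<Rightarrow> real"
  assumes "X \<in> borel_measurable M" "integrable M (\<lambda>\<omega>. X \<omega> ^ 4)" "k \<le> 4"
  shows "integrable M (\<lambda>\<omega>. X \<omega> ^ k)"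
proof (rule Bochner_Integration.integrable_bound)
  show "integrable M (\<lambda>\<omega>. 1 + X \<omega> ^ 4)" using assms by simp
  show "AE \<omega> in M. norm (X \<omega> ^ k) \<le> norm (1 + X \<omega> ^ 4)"
  proof (rule AE_I2)
    fix \<omega>
    have "0 \<le> X \<omega> ^ 4" by simp
    then show "norm (X \<omega> ^ k) \<le> norm (1 + X \<omega> ^ 4)"
      using power_le_one_plus_power4[OF assms(3), of "X \<omega>"] by (simp add: power_abs)
  qed
qed (use assms in simp)

lemma (in prob_space) indep_partial_sum:
  fixes X :: "nat \<Rightarrow> 'a \<Rightarrow> real"
  assumes "indep_vars (\<lambda>_. borel) X UNIV"
  shows "indep_var borel (X n) borel (\<lambda>\<omega>. \<Sum>i<n. X i \<omega>)"
proof -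
  have "indep_vars (\<lambda>_. borel) X (insert n {..<n})"
    by (rule indep_vars_subset[OF assms]) simp
  from indep_vars_sum[OF _ _ this] show ?thesis by simp
qed

text \<open>In the expansion of \<open>(S + X)^4\<close> independence and zero means remove the
  terms with \<open>S^3 * X\<close> and \<open>S * X^3\<close>. What remains grows by a multiple of
  the second moment of \<open>S\<close>, which is linear in \<open>n\<close>, so the total is only
  quadratic; dividing by \<open>n^4\<close> then gives a summable bound.\<close>

lemma (in prob_space) fourth_moment_partial_sum:
  fixes X :: "nat \<Rightarrow> 'a \<Rightarrow> real"
  assumes indep: "indep_vars (\<lambda>_. borel) X UNIV"
    and i4: "\<And>i. integrable M (\<lambda>\<omega>. X i \<omega> ^ 4)"
    and mean: "\<And>i. expectation (X i) = 0"
    and bound: "\<And>i. expectation (\<lambda>\<omega>. X i \<omega> ^ 4) \<le> B"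
  shows "integrable M (\<lambda>\<omega>. (\<Sum>i<n. X i \<omega>) ^ 4)"
    and "expectation (\<lambda>\<omega>. (\<Sum>i<n. X i \<omega>) ^ 4) \<le> 6 * (1 + B)\<^sup>2 * (real n)\<^sup>2"
proof -
  have Xm[measurable]: "X i \<in> borel_measurable M" for i
    using indep by (auto simp: indep_vars_def)
  define S where "S = (\<lambda>n \<omega>. \<Sum>i<n. X i \<omega>)"
  have Sm[measurable]: "S n \<in> borel_measurable M" for n unfolding S_def by measurable
  have S_Suc: "S (Suc n) = (\<lambda>\<omega>. S n \<omega> + X n \<omega>)" for n by (simp add: S_def)
  have Xi: "integrable M (\<lambda>\<omega>. X i \<omega> ^ k)" if "k \<le> 4" for i k
    by (rule integrable_power_of_power4[OF Xm i4 that])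
  have B: "B \<ge> 0"
    by (rule order_trans[OF Bochner_Integration.integral_nonneg bound[of 0]]) simp
  have X2: "expectation (\<lambda>\<omega>. X i \<omega> ^ 2) \<le> 1 + B" for i
  proof -
    have "expectation (\<lambda>\<omega>. X i \<omega> ^ 2) \<le> expectation (\<lambda>\<omega>. 1 + X i \<omega> ^ 4)"
      using power_le_one_plus_power4[of 2 "X i \<omega>" for \<omega>] Xi i4 by (intro integral_mono) auto
    also have "\<dots> \<le> 1 + B" using bound[of i] i4 by (simp add: prob_space)
    finally show ?thesis .
  qed
  have Si4: "integrable M (\<lambda>\<omega>. S n \<omega> ^ 4)" for n
  proof (induction n)
    case 0
    then show ?case by (simp add: S_def)
  next
    case (Suc n)
    show ?case
    proof (rule Bochner_Integration.integrable_bound)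
      \<comment> \<open>The factor 8 comes from applying
        \<open>(a + b)^2 \<le> 2 * (a^2 + b^2)\<close> twice.\<close>
      show "integrable M (\<lambda>\<omega>. 8 * (S n \<omega> ^ 4 + X n \<omega> ^ 4))" using Suc i4 by simp
      have sq: "(a + b)\<^sup>2 \<le> 2 * (a\<^sup>2 + b\<^sup>2)" for a b :: real
        using sum_squares_bound[of a b] by (simp add: power2_sum)
      have "(a + b) ^ 4 \<le> 8 * (a ^ 4 + b ^ 4)" for a b :: real
      proof -
        have "((a + b)\<^sup>2)\<^sup>2 \<le> (2 * (a\<^sup>2 + b\<^sup>2))\<^sup>2" by (intro power_mono sq) simp
        also have "\<dots> = 4 * (a\<^sup>2 + b\<^sup>2)\<^sup>2" by (simp only: power_mult_distrib) simp
        also have "\<dots> \<le> 4 * (2 * ((a\<^sup>2)\<^sup>2 + (b\<^sup>2)\<^sup>2))"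
          by (intro mult_left_mono sq) simp
        finally show ?thesis by simp
      qed
      then show "AE \<omega> in M. norm (S (Suc n) \<omega> ^ 4) \<le> norm (8 * (S n \<omega> ^ 4 + X n \<omega> ^ 4))"
        by (simp add: S_Suc)
    qed simp
  qed
  have Si: "integrable M (\<lambda>\<omega>. S n \<omega> ^ k)" if "k \<le> 4" for n k
    by (rule integrable_power_of_power4[OF Sm Si4 that])
  have prod: "integrable M (\<lambda>\<omega>. S n \<omega> ^ k * X n \<omega> ^ l)"
     "expectation (\<lambda>\<omega>. S n \<omega> ^ k * X n \<omega> ^ l) = expectation (\<lambda>\<omega>. S n \<omega> ^ k) * expectation (\<lambda>\<omega>. X n \<omega> ^ l)"
    if "k \<le> 4" "l \<le> 4" for n k l
  proof -
    have "indep_var borel ((\<lambda>x. x ^ l) \<circ> X n) borel ((\<lambda>x. x ^ k) \<circ> S n)"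
      using indep_partial_sum[OF indep, of n] by (intro indep_var_compose[of borel _ borel]) (auto simp: S_def)
    then have "indep_var borel (\<lambda>\<omega>. X n \<omega> ^ l) borel (\<lambda>\<omega>. S n \<omega> ^ k)" by (simp add: comp_def)
    from indep_var_integrable[OF this] indep_var_lebesgue_integral[OF this] that Si Xi
    show "integrable M (\<lambda>\<omega>. S n \<omega> ^ k * X n \<omega> ^ l)"
     "expectation (\<lambda>\<omega>. S n \<omega> ^ k * X n \<omega> ^ l) = expectation (\<lambda>\<omega>. S n \<omega> ^ k) * expectation (\<lambda>\<omega>. X n \<omega> ^ l)"
      by (auto simp: mult.commute)
  qed
  have S1: "expectation (S n) = 0" for n
    unfolding S_def using Xi[of 1] mean by (subst Bochner_Integration.integral_sum) auto
  have S2: "expectation (\<lambda>\<omega>. S n \<omega> ^ 2) \<le> real n * (1 + B)" for n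
  proof (induction n)
    case 0
    then show ?case by (simp add: S_def)
  next
    case (Suc n)
    have eq: "(\<lambda>\<omega>. S (Suc n) \<omega> ^ 2) = (\<lambda>\<omega>. S n \<omega> ^ 2 + X n \<omega> ^ 2 + 2 * (S n \<omega> ^ 1 * X n \<omega> ^ 1))"
      by (simp add: S_Suc power2_sum mult.assoc)
    have "expectation (\<lambda>\<omega>. S (Suc n) \<omega> ^ 2)
       = expectation (\<lambda>\<omega>. S n \<omega> ^ 2) + expectation (\<lambda>\<omega>. X n \<omega> ^ 2) + 2 * expectation (\<lambda>\<omega>. S n \<omega> ^ 1 * X n \<omega> ^ 1)"
      unfolding eq using Si[of 2 n] Xi[of 2 n] prod(1)[of 1 1 n]
      by (simp del: power_one_right)
    also have "\<dots> = expectation (\<lambda>\<omega>. S n \<omega> ^ 2) + expectation (\<lambda>\<omega>. X n \<omega> ^ 2)"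
      using prod(2)[of 1 1 n] mean by simp
    finally show ?case using Suc X2[of n] by (simp add: algebra_simps)
  qed
  have S4: "expectation (\<lambda>\<omega>. S n \<omega> ^ 4) \<le> 6 * (1 + B)\<^sup>2 * (real n)\<^sup>2" for n
  proof (induction n)
    case 0
    then show ?case by (simp add: S_def)
  next
    case (Suc n)
    have eq: "(\<lambda>\<omega>. S (Suc n) \<omega> ^ 4) = (\<lambda>\<omega>. S n \<omega> ^ 4 + 4 * (S n \<omega> ^ 3 * X n \<omega> ^ 1)
        + 6 * (S n \<omega> ^ 2 * X n \<omega> ^ 2) + 4 * (S n \<omega> ^ 1 * X n \<omega> ^ 3) + X n \<omega> ^ 4)"
      by (simp add: S_Suc fun_eq_iff power4_eq_xxxx power3_eq_cube power2_eq_square algebra_simps)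
    have "expectation (\<lambda>\<omega>. S (Suc n) \<omega> ^ 4) = expectation (\<lambda>\<omega>. S n \<omega> ^ 4)
        + 4 * expectation (\<lambda>\<omega>. S n \<omega> ^ 3 * X n \<omega> ^ 1)
        + 6 * expectation (\<lambda>\<omega>. S n \<omega> ^ 2 * X n \<omega> ^ 2) + 4 * expectation (\<lambda>\<omega>. S n \<omega> ^ 1 * X n \<omega> ^ 3)
        + expectation (\<lambda>\<omega>. X n \<omega> ^ 4)"
      unfolding eq using Si[of 4 n] Xi[of 4 n] prod(1)[of 3 1 n] prod(1)[of 2 2 n] prod(1)[of 1 3 n]
      by (simp del: power_one_right)
    also have "\<dots> = expectation (\<lambda>\<omega>. S n \<omega> ^ 4)
        + 6 * (expectation (\<lambda>\<omega>. S n \<omega> ^ 2) * expectation (\<lambda>\<omega>. X n \<omega> ^ 2)) + expectation (\<lambda>\<omega>. X n \<omega> ^ 4)"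
      using prod(2)[of 3 1 n] prod(2)[of 2 2 n] prod(2)[of 1 3 n] mean S1 by simp
    also have "\<dots> \<le> 6 * (1 + B)\<^sup>2 * (real n)\<^sup>2 + 6 * ((real n * (1 + B)) * (1 + B)) + B"
      using Suc bound[of n] S2[of n] X2[of n] B
      by (intro add_mono mult_left_mono mult_mono) auto
    also have "\<dots> \<le> 6 * (1 + B)\<^sup>2 * (real (Suc n))\<^sup>2"
    \<comment> \<open>Passing from \<open>n^2\<close> to \<open>(n + 1)^2\<close> frees
      \<open>2 * n + 1\<close> copies of \<open>6 * (1 + B)^2\<close>: \<open>n\<close> of them pay
      for the cross term and one pays for \<open>B\<close>.\<close>
    proof -
      have "B \<le> (1 + B)\<^sup>2" "0 \<le> real n * (1 + B)\<^sup>2" "0 \<le> (1 + B)\<^sup>2"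
        using B by (auto simp: power2_eq_square algebra_simps)
      moreover have "6 * (1 + B)\<^sup>2 * (real (Suc n))\<^sup>2 =
          6 * (1 + B)\<^sup>2 * (real n)\<^sup>2 + 6 * ((real n * (1 + B)) * (1 + B)) + 6 * (real n * (1 + B)\<^sup>2) + 6 * (1 + B)\<^sup>2"
        by (simp add: power2_eq_square algebra_simps)
      ultimately show ?thesis by linarith
    qed
    finally show ?case .
  qed
  show "integrable M (\<lambda>\<omega>. (\<Sum>i<n. X i \<omega>) ^ 4)" "expectation (\<lambda>\<omega>. (\<Sum>i<n. X i \<omega>) ^ 4) \<le> 6 * (1 + B)\<^sup>2 * (real n)\<^sup>2"
    using Si4[of n] S4[of n] by (simp_all add: S_def)
qed

text \<open>The fourth powers of the averages have summable expectations, so their sum is almost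
  surely finite and the terms tend to zero along the whole sequence.\<close>

lemma (in prob_space) strong_law_fourth_moment_centered:
  fixes X :: "nat \<Rightarrow> 'a \<Rightarrow> real"
  assumes indep: "indep_vars (\<lambda>_. borel) X UNIV"
    and i4: "\<And>i. integrable M (\<lambda>\<omega>. X i \<omega> ^ 4)"
    and mean: "\<And>i. expectation (X i) = 0"
    and bound: "\<And>i. expectation (\<lambda>\<omega>. X i \<omega> ^ 4) \<le> B"
  shows "AE \<omega> in M. (\<lambda>n. (\<Sum>i<n. X i \<omega>) / real n) \<longlonglongrightarrow> 0"
proof -
  have Xm[measurable]: "X i \<in> borel_measurable M" for i
    using indep by (auto simp: indep_vars_def)
  define f where "f = (\<lambda>n \<omega>. ((\<Sum>i<n. X i \<omega>) / real n) ^ 4)"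
  note m4 = fourth_moment_partial_sum[OF assms]
  have fm[measurable]: "f n \<in> borel_measurable M" for n unfolding f_def by measurable
  have fi: "integrable M (f n)" for n
    using m4(1)[of n] by (simp add: f_def power_divide)
  have f0: "0 \<le> f n \<omega>" for n \<omega> by (simp add: f_def)
  \<comment> \<open>At \<open>n = 0\<close> both sides are 0, division by zero being 0.\<close>
  have fle: "expectation (f n) \<le> 6 * (1 + B)\<^sup>2 * (1 / (real n)\<^sup>2)" for n
  proof (cases "n = 0")
    case False
    have "expectation (f n) = expectation (\<lambda>\<omega>. (\<Sum>i<n. X i \<omega>) ^ 4) / real n ^ 4"
      by (simp add: f_def power_divide)
    also have "\<dots> \<le> (6 * (1 + B)\<^sup>2 * (real n)\<^sup>2) / real n ^ 4"
      by (intro divide_right_mono m4) simp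
    also have "\<dots> = 6 * (1 + B)\<^sup>2 * (1 / (real n)\<^sup>2)"
      using False by (simp add: field_simps power2_eq_square power4_eq_xxxx)
    finally show ?thesis .
  qed (simp add: f_def)
  have "(\<integral>\<^sup>+\<omega>. (\<Sum>n. ennreal (f n \<omega>)) \<partial>M) = (\<Sum>n. \<integral>\<^sup>+\<omega>. ennreal (f n \<omega>) \<partial>M)"
    by (rule nn_integral_suminf) simp
  also have "\<dots> = (\<Sum>n. ennreal (expectation (f n)))"
    using fi f0 by (simp add: nn_integral_eq_integral)
  also have "\<dots> < top"
  proof -
    have "summable (\<lambda>n. 6 * (1 + B)\<^sup>2 * (1 / (real n)\<^sup>2))"
      using inverse_power_summable[of 2, where 'a=real] by (intro summable_mult) (simp add: inverse_eq_divide)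
    then have "summable (\<lambda>n. expectation (f n))"
      by (rule summable_comparison_test'[where N=0]) (use fle f0 in \<open>simp add: integral_nonneg_AE\<close>)
    then show ?thesis
      using f0 by (subst suminf_ennreal_eq[OF _ summable_sums]) (auto intro!: integral_nonneg_AE)
  qed
  finally have "AE \<omega> in M. (\<Sum>n. ennreal (f n \<omega>)) \<noteq> \<infinity>"
    by (intro nn_integral_PInf_AE) auto
  then show ?thesis
  proof eventually_elim
    case (elim \<omega>)
    then have "summable (\<lambda>n. f n \<omega>)"
      by (intro summable_suminf_not_top f0) simp
    then have "(\<lambda>n. \<bar>f n \<omega>\<bar>) \<longlonglongrightarrow> 0"
      using f0 by (simp add: summable_LIMSEQ_zero)
    then have "(\<lambda>n. root 4 (f n \<omega>)) \<longlonglongrightarrow> root 4 0"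
      using f0 by (intro tendsto_real_root) simp
    moreover have "root 4 (f n \<omega>) = \<bar>(\<Sum>i<n. X i \<omega>) / real n\<bar>" for n
    proof -
      have "f n \<omega> = \<bar>(\<Sum>i<n. X i \<omega>) / real n\<bar> ^ 4" unfolding f_def by (rule power_even_abs[symmetric]) simp
      then show ?thesis by (simp only: real_root_power_cancel abs_ge_zero zero_less_numeral)
    qed
    ultimately show ?case
      by (subst tendsto_rabs_zero_iff[symmetric]) simp
  qed
qed

lemma (in prob_space) strong_law_fourth_moment:
  fixes X :: "nat \<Rightarrow> 'a \<Rightarrow> real"
  assumes indep: "indep_vars (\<lambda>_. borel) X UNIV"
    and i4: "\<And>i. integrable M (\<lambda>\<omega>. X i \<omega> ^ 4)"
    and mean: "\<And>i. expectation (X i) = \<mu>"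
    and bound: "\<And>i. expectation (\<lambda>\<omega>. (X i \<omega> - \<mu>) ^ 4) \<le> B"
  shows "AE \<omega> in M. (\<lambda>n. (\<Sum>i<n. X i \<omega>) / real n) \<longlonglongrightarrow> \<mu>"
proof -
  have Xm[measurable]: "X i \<in> borel_measurable M" for i
    using indep by (auto simp: indep_vars_def)
  have Xi: "integrable M (\<lambda>\<omega>. X i \<omega> ^ k)" if "k \<le> 4" for i k
    by (rule integrable_power_of_power4[OF Xm i4 that])
  have "AE \<omega> in M. (\<lambda>n. (\<Sum>i<n. X i \<omega> - \<mu>) / real n) \<longlonglongrightarrow> 0"
  proof (rule strong_law_fourth_moment_centered[OF _ _ _ bound])
    show "indep_vars (\<lambda>_. borel) (\<lambda>i \<omega>. X i \<omega> - \<mu>) UNIV"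
      using indep by (rule indep_vars_compose2) simp
    fix i
    have eq: "(X i \<omega> - \<mu>) ^ 4 = X i \<omega> ^ 4 - 4 * \<mu> * X i \<omega> ^ 3 + 6 * \<mu>\<^sup>2 * X i \<omega> ^ 2 - 4 * \<mu> ^ 3 * X i \<omega> ^ 1 + \<mu> ^ 4" for \<omega>
      by (simp add: power4_eq_xxxx power3_eq_cube power2_eq_square algebra_simps)
    show "integrable M (\<lambda>\<omega>. (X i \<omega> - \<mu>) ^ 4)"
      unfolding eq using Xi[of 1 i] Xi[of 2 i] Xi[of 3 i] Xi[of 4 i] by simp
    show "expectation (\<lambda>\<omega>. X i \<omega> - \<mu>) = 0"
      using Xi[of 1 i] mean[of i] by (simp add: prob_space)
  qed
  then show ?thesis
  proof eventually_elim
    case (elim \<omega>)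
    then have "(\<lambda>n. (\<Sum>i<n. X i \<omega> - \<mu>) / real n + \<mu>) \<longlonglongrightarrow> \<mu>"
      using tendsto_add[OF elim tendsto_const[of \<mu>]] by simp
    \<comment> \<open>At \<open>n = 0\<close> the left side is \<open>\<mu>\<close> and the right
      side is 0, so the equality is only eventual.\<close>
    moreover have "\<forall>\<^sub>F n in sequentially. (\<Sum>i<n. X i \<omega> - \<mu>) / real n + \<mu> = (\<Sum>i<n. X i \<omega>) / real n"
      using eventually_gt_at_top[of 0] by eventually_elim (simp add: sum_subtractf field_simps)
    ultimately show ?case by (rule Lim_transform_eventually)
  qed
qed

section \<open>Envelope theorem\<close>

text \<open>The sequential form is the one that fits dominated convergence and the extraction of
  convergent maximisers from a compact set.\<close>

lemma has_gradient_within_sequentially: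
  "has_gradient_within f D z S \<longleftrightarrow>
    (\<forall>zs. (\<forall>n. zs n \<in> S - {z}) \<longrightarrow> zs \<longlonglongrightarrow> z \<longrightarrow>
      (\<lambda>n. (f (zs n) - f z - (zs n - z) \<bullet> D) / norm (zs n - z)) \<longlonglongrightarrow> 0)"
  by (simp add: has_gradient_within_def has_derivative_within tendsto_at_iff_sequentially comp_def
      bounded_linear_inner_left diff_diff_eq divide_inverse mult.commute)

text \<open>\<open>D y\<close> is the gradient of \<open>\<phi> y\<close> at \<open>z0\<close>, with an error \<open>o(norm (z - z0))\<close> that is uniform for
  \<open>x\<close> near \<open>y\<close>; the increment of \<open>\<phi> x\<close> is compared with \<open>D y\<close>, not \<open>D x\<close>.\<close>

definition family_gradient ::
  "'a::metric_space set \<Rightarrow> 'c::euclidean_space set \<Rightarrow> 'c \<Rightarrow> ('a \<Rightarrow> 'c \<Rightarrow> real) \<Rightarrow> ('a \<Rightarrow> 'c) \<Rightarrow> bool" where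
  "family_gradient A S z0 \<phi> D \<longleftrightarrow>
     continuous_on A (\<lambda>x. \<phi> x z0) \<and>
     (\<forall>y\<in>A. \<forall>xs zs. (\<forall>n. xs n \<in> A) \<longrightarrow> xs \<longlonglongrightarrow> y \<longrightarrow> (\<forall>n. zs n \<in> S - {z0}) \<longrightarrow> zs \<longlonglongrightarrow> z0 \<longrightarrow>
        (\<lambda>n. (\<phi> (xs n) (zs n) - \<phi> (xs n) z0 - (zs n - z0) \<bullet> D y) / norm (zs n - z0)) \<longlonglongrightarrow> 0)"

lemma family_gradientI:
  assumes "continuous_on A (\<lambda>x. \<phi> x z0)"
    and "\<And>y xs zs. \<lbrakk>y \<in> A; \<And>n. xs n \<in> A; xs \<longlonglongrightarrow> y; \<And>n. zs n \<in> S - {z0}; zs \<longlonglongrightarrow> z0\<rbrakk> \<Longrightarrow>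
        (\<lambda>n. (\<phi> (xs n) (zs n) - \<phi> (xs n) z0 - (zs n - z0) \<bullet> D y) / norm (zs n - z0)) \<longlonglongrightarrow> 0"
  shows "family_gradient A S z0 \<phi> D"
  using assms unfolding family_gradient_def by blast

lemma family_gradientD:
  assumes "family_gradient A S z0 \<phi> D" "y \<in> A" "\<And>n. xs n \<in> A" "xs \<longlonglongrightarrow> y"
    "\<And>n. zs n \<in> S - {z0}" "zs \<longlonglongrightarrow> z0"
  shows "(\<lambda>n. \<phi> (xs n) z0) \<longlonglongrightarrow> \<phi> y z0"
    and "(\<lambda>n. (\<phi> (xs n) (zs n) - \<phi> (xs n) z0 - (zs n - z0) \<bullet> D y) / norm (zs n - z0)) \<longlonglongrightarrow> 0"
    and "(\<lambda>n. \<phi> (xs n) (zs n)) \<longlonglongrightarrow> \<phi> y z0"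
proof -
  show 1: "(\<lambda>n. \<phi> (xs n) z0) \<longlonglongrightarrow> \<phi> y z0"
    using assms unfolding family_gradient_def continuous_on_sequentially by (auto simp: comp_def)
  show 2: "(\<lambda>n. (\<phi> (xs n) (zs n) - \<phi> (xs n) z0 - (zs n - z0) \<bullet> D y) / norm (zs n - z0)) \<longlonglongrightarrow> 0"
    using assms unfolding family_gradient_def by blast
  have "(\<lambda>n. (\<phi> (xs n) (zs n) - \<phi> (xs n) z0 - (zs n - z0) \<bullet> D y) / norm (zs n - z0) * norm (zs n - z0)
     + (zs n - z0) \<bullet> D y + \<phi> (xs n) z0) \<longlonglongrightarrow> 0 * norm (z0 - z0) + (z0 - z0) \<bullet> D y + \<phi> y z0"
    by (intro tendsto_intros 1 2 assms(6))
  moreover have "(\<phi> (xs n) (zs n) - \<phi> (xs n) z0 - (zs n - z0) \<bullet> D y) / norm (zs n - z0) * norm (zs n - z0)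
     + (zs n - z0) \<bullet> D y + \<phi> (xs n) z0 = \<phi> (xs n) (zs n)" for n
    using assms(5)[of n] by simp
  ultimately show "(\<lambda>n. \<phi> (xs n) (zs n)) \<longlonglongrightarrow> \<phi> y z0" by simp
qed

lemma family_gradient_imp_has_gradient_within:
  assumes "family_gradient A S z0 \<phi> D" "y \<in> A"
  shows "has_gradient_within (\<phi> y) (D y) z0 S"
  unfolding has_gradient_within_sequentially
  using family_gradientD(2)[OF assms, of "\<lambda>_. y"] assms(2) by auto

lemma family_gradient_of_has_gradient_within:
  assumes "has_gradient_within q D z0 S"
  shows "family_gradient A S z0 (\<lambda>_. q) (\<lambda>_. D)"
  using assms unfolding has_gradient_within_sequentially by (intro family_gradientI) auto

lemma family_gradient_const:
  assumes "continuous_on A c"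
  shows "family_gradient A S z0 (\<lambda>x _. c x) (\<lambda>_. 0)"
  using assms by (intro family_gradientI) auto

lemma family_gradient_add:
  assumes "family_gradient A S z0 \<phi> D" "family_gradient A S z0 \<psi> E"
  shows "family_gradient A S z0 (\<lambda>x z. \<phi> x z + \<psi> x z) (\<lambda>x. D x + E x)"
proof (rule family_gradientI)
  show "continuous_on A (\<lambda>x. \<phi> x z0 + \<psi> x z0)"
    using assms unfolding family_gradient_def by (intro continuous_intros) auto
  fix y xs zs
  assume seq: "y \<in> A" "\<And>n. xs n \<in> A" "xs \<longlonglongrightarrow> y" "\<And>n. zs n \<in> S - {z0}" "zs \<longlonglongrightarrow> z0"
  show "(\<lambda>n. (\<phi> (xs n) (zs n) + \<psi> (xs n) (zs n) - (\<phi> (xs n) z0 + \<psi> (xs n) z0)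
      - (zs n - z0) \<bullet> (D y + E y)) / norm (zs n - z0)) \<longlonglongrightarrow> 0"
    using tendsto_add[OF family_gradientD(2)[OF assms(1) seq] family_gradientD(2)[OF assms(2) seq]]
    by (simp add: add_divide_distrib[symmetric] inner_add_right algebra_simps)
qed

lemma family_gradient_mult:
  assumes "family_gradient A S z0 \<phi> D" "family_gradient A S z0 \<psi> E"
  shows "family_gradient A S z0 (\<lambda>x z. \<phi> x z * \<psi> x z) (\<lambda>x. \<phi> x z0 *\<^sub>R E x + \<psi> x z0 *\<^sub>R D x)"
proof (rule family_gradientI)
  show "continuous_on A (\<lambda>x. \<phi> x z0 * \<psi> x z0)"
    using assms unfolding family_gradient_def by (intro continuous_intros) auto
  fix y xs zs
  assume seq: "y \<in> A" "\<And>n. xs n \<in> A" "xs \<longlonglongrightarrow> y" "\<And>n. zs n \<in> S - {z0}" "zs \<longlonglongrightarrow> z0"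
  note \<phi> = family_gradientD[OF assms(1) seq] and \<psi> = family_gradientD[OF assms(2) seq]
  let ?h = "\<lambda>n. zs n - z0"
  have bounded: "(\<lambda>n. (?h n \<bullet> v) / norm (?h n) * r n) \<longlonglongrightarrow> 0" if "r \<longlonglongrightarrow> 0" for v r
  proof (rule Lim_null_comparison)
    show "\<forall>\<^sub>F n in sequentially. norm ((?h n \<bullet> v) / norm (?h n) * r n) \<le> norm v * \<bar>r n\<bar>"
    proof (rule always_eventually, rule allI)
      fix n
      have "norm (?h n) > 0" using seq(4)[of n] by simp
      then have "\<bar>?h n \<bullet> v\<bar> / norm (?h n) \<le> norm v"
        using Cauchy_Schwarz_ineq2[of "?h n" v] by (simp add: field_simps)
      then show "norm ((?h n \<bullet> v) / norm (?h n) * r n) \<le> norm v * \<bar>r n\<bar>"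
        using mult_right_mono[OF _ abs_ge_zero[of "r n"]] by (simp only: real_norm_def abs_mult abs_divide abs_norm_cancel)
    qed
    show "(\<lambda>n. norm v * \<bar>r n\<bar>) \<longlonglongrightarrow> 0"
      using tendsto_mult[OF tendsto_const[of "norm v"] tendsto_rabs[OF that]] by simp
  qed
  \<comment> \<open>Product rule with a moving \<open>x\<close>: the first and third summands carry
    the differentiation errors of \<open>\<phi>\<close> and \<open>\<psi>\<close>, the other two the
    cost of replacing the values along the sequences by those at \<open>y\<close> and
    \<open>z0\<close>. The latter are bounded quotients times null sequences.\<close>
  have "(\<lambda>n. (\<phi> (xs n) (zs n) - \<phi> (xs n) z0 - ?h n \<bullet> D y) / norm (?h n) * \<psi> (xs n) (zs n)
     + (?h n \<bullet> D y) / norm (?h n) * (\<psi> (xs n) (zs n) - \<psi> y z0)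
     + \<phi> (xs n) z0 * ((\<psi> (xs n) (zs n) - \<psi> (xs n) z0 - ?h n \<bullet> E y) / norm (?h n))
     + (?h n \<bullet> E y) / norm (?h n) * (\<phi> (xs n) z0 - \<phi> y z0))
     \<longlonglongrightarrow> 0 * \<psi> y z0 + 0 + \<phi> y z0 * 0 + 0"
    using \<phi>(1) \<psi>(3)
    by (intro tendsto_intros \<phi> \<psi> bounded) (simp_all add: LIM_zero_iff)
  moreover have "(\<phi> (xs n) (zs n) - \<phi> (xs n) z0 - ?h n \<bullet> D y) / norm (?h n) * \<psi> (xs n) (zs n)
     + (?h n \<bullet> D y) / norm (?h n) * (\<psi> (xs n) (zs n) - \<psi> y z0)
     + \<phi> (xs n) z0 * ((\<psi> (xs n) (zs n) - \<psi> (xs n) z0 - ?h n \<bullet> E y) / norm (?h n))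
     + (?h n \<bullet> E y) / norm (?h n) * (\<phi> (xs n) z0 - \<phi> y z0)
     = (\<phi> (xs n) (zs n) * \<psi> (xs n) (zs n) - \<phi> (xs n) z0 * \<psi> (xs n) z0
       - ?h n \<bullet> (\<phi> y z0 *\<^sub>R E y + \<psi> y z0 *\<^sub>R D y)) / norm (?h n)" (is "?l n = ?r n") for n
  proof -
    have "norm (?h n) \<noteq> 0" using seq(4)[of n] by simp
    then show ?thesis
      by (simp add: divide_simps inner_add_right) (simp add: algebra_simps)
  qed
  ultimately show "(\<lambda>n. ?r n) \<longlonglongrightarrow> 0" by simp
qed

lemma family_gradient_sum:
  assumes "finite I" "\<And>i. i \<in> I \<Longrightarrow> family_gradient A S z0 (\<phi> i) (D i)"
  shows "family_gradient A S z0 (\<lambda>x z. \<Sum>i\<in>I. \<phi> i x z) (\<lambda>x. \<Sum>i\<in>I. D i x)"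
  using assms
proof (induction I rule: finite_induct)
  case empty
  then show ?case using family_gradient_const[of A "\<lambda>_. 0"] by simp
next
  case (insert i I)
  then show ?case using family_gradient_add[of A S z0 "\<phi> i" "D i"] by simp
qed

text \<open>The property only sees points near \<open>z0\<close>. This is how the case distinction
  in \<open>sigma_tilde\<close> and the purely local smoothness of \<open>lam\<close> are
  handled.\<close>

lemma family_gradient_transform:
  assumes fg: "family_gradient A S z0 \<phi> D" and "z0 \<in> S" "e > 0"
    and eq: "\<And>x z. x \<in> A \<Longrightarrow> z \<in> S \<Longrightarrow> dist z z0 < e \<Longrightarrow> \<psi> x z = \<phi> x z"
  shows "family_gradient A S z0 \<psi> D"
proof (rule family_gradientI)
  have eq0: "\<psi> x z0 = \<phi> x z0" if "x \<in> A" for x using eq[OF that] assms by simp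
  then show "continuous_on A (\<lambda>x. \<psi> x z0)"
    using fg unfolding family_gradient_def by (simp cong: continuous_on_cong)
  fix y xs zs
  assume seq: "y \<in> A" "\<And>n. xs n \<in> A" "xs \<longlonglongrightarrow> y" "\<And>n. zs n \<in> S - {z0}" "zs \<longlonglongrightarrow> z0"
  have "\<forall>\<^sub>F n in sequentially. dist (zs n) z0 < e"
    using seq(5) \<open>e > 0\<close> by (rule tendstoD)
  then have "\<forall>\<^sub>F n in sequentially. (\<phi> (xs n) (zs n) - \<phi> (xs n) z0 - (zs n - z0) \<bullet> D y) / norm (zs n - z0)
     = (\<psi> (xs n) (zs n) - \<psi> (xs n) z0 - (zs n - z0) \<bullet> D y) / norm (zs n - z0)"
  proof eventually_elim
    case (elim n)
    then show ?case using eq[of "xs n" "zs n"] eq0[of "xs n"] seq(2,4)[of n] by simp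
  qed
  with family_gradientD(2)[OF fg seq]
  show "(\<lambda>n. (\<psi> (xs n) (zs n) - \<psi> (xs n) z0 - (zs n - z0) \<bullet> D y) / norm (zs n - z0)) \<longlonglongrightarrow> 0"
    by (rule Lim_transform_eventually)
qed

text \<open>If no constant worked, there would be \<open>xs n\<close> and \<open>zs n\<close>
  tending to \<open>z0\<close> with slope above \<open>n\<close>. By compactness the
  \<open>xs n\<close> accumulate at some \<open>y\<close>, and along that subsequence the slopes are
  eventually below \<open>1 + norm (D y)\<close>.\<close>

lemma family_gradient_lipschitz:
  assumes A: "compact A" and fg: "family_gradient A S z0 \<phi> D"
  shows "\<exists>L e. 0 < e \<and> 0 \<le> L \<and>
    (\<forall>x\<in>A. \<forall>z\<in>S. dist z z0 < e \<longrightarrow> \<bar>\<phi> x z - \<phi> x z0\<bar> \<le> L * dist z z0)"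
proof (rule ccontr)
  assume neg: "\<not> ?thesis"
  have "\<exists>x z. x \<in> A \<and> z \<in> S \<and> dist z z0 < inverse (real (Suc n)) \<and> \<bar>\<phi> x z - \<phi> x z0\<bar> > real n * dist z z0" for n
  proof (rule ccontr)
    assume "\<nexists>x z. x \<in> A \<and> z \<in> S \<and> dist z z0 < inverse (real (Suc n)) \<and> \<bar>\<phi> x z - \<phi> x z0\<bar> > real n * dist z z0"
    then have "0 < inverse (real (Suc n)) \<and> 0 \<le> real n \<and>
      (\<forall>x\<in>A. \<forall>z\<in>S. dist z z0 < inverse (real (Suc n)) \<longrightarrow> \<bar>\<phi> x z - \<phi> x z0\<bar> \<le> real n * dist z z0)"
      by (intro conjI ballI impI) (simp_all del: of_nat_Suc, meson not_le)
    with neg show False by blast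
  qed
  then obtain xs zs where seq: "\<And>n. xs n \<in> A" "\<And>n. zs n \<in> S"
    "\<And>n. dist (zs n) z0 < inverse (real (Suc n))" "\<And>n. \<bar>\<phi> (xs n) (zs n) - \<phi> (xs n) z0\<bar> > real n * dist (zs n) z0"
    by metis
  have ne: "zs n \<noteq> z0" for n using seq(4)[of n] by auto
  have zlim: "zs \<longlonglongrightarrow> z0"
    using seq(3) by (intro metric_tendsto_imp_tendsto[OF LIMSEQ_inverse_real_of_nat] always_eventually)
      (simp add: less_imp_le)
  obtain y r where y: "y \<in> A" "strict_mono r" "(xs \<circ> r) \<longlonglongrightarrow> y"
    using A seq(1) by (metis compact_def)
  have q: "(\<lambda>n. (\<phi> (xs (r n)) (zs (r n)) - \<phi> (xs (r n)) z0 - (zs (r n) - z0) \<bullet> D y) / norm (zs (r n) - z0)) \<longlonglongrightarrow> 0"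
    using y seq ne LIMSEQ_subseq_LIMSEQ[OF zlim y(2)]
    by (intro family_gradientD(2)[OF fg]) (auto simp: comp_def)
  have "\<forall>\<^sub>F n in sequentially. \<bar>(\<phi> (xs (r n)) (zs (r n)) - \<phi> (xs (r n)) z0 - (zs (r n) - z0) \<bullet> D y) / norm (zs (r n) - z0)\<bar> < 1"
    using tendstoD[OF q, of 1] by (simp add: dist_real_def)
  moreover have "\<forall>\<^sub>F n in sequentially. real n > 1 + norm (D y)"
    using filterlim_real_sequentially by (simp add: filterlim_at_top_dense)
  ultimately obtain n where elim: "\<bar>(\<phi> (xs (r n)) (zs (r n)) - \<phi> (xs (r n)) z0 - (zs (r n) - z0) \<bullet> D y) / norm (zs (r n) - z0)\<bar> < 1"
      "real n > 1 + norm (D y)"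
    using eventually_happens'[OF sequentially_bot eventually_conj] by blast
  show False
  proof -
    let ?h = "zs (r n) - z0" and ?d = "\<phi> (xs (r n)) (zs (r n)) - \<phi> (xs (r n)) z0"
    have h: "norm ?h > 0" using ne by simp
    have "\<bar>?d - ?h \<bullet> D y\<bar> < norm ?h" using elim(1) h by (simp add: abs_divide divide_less_eq)
    moreover have "\<bar>?h \<bullet> D y\<bar> \<le> norm ?h * norm (D y)" by (rule Cauchy_Schwarz_ineq2)
    ultimately have "\<bar>?d\<bar> < (1 + norm (D y)) * norm ?h" by (simp add: algebra_simps)
    \<comment> \<open>A subsequence index satisfies \<open>n \<le> r n\<close>, so the assumed slope
      bound at \<open>r n\<close> is at least \<open>n\<close>.\<close>
    also have "\<dots> \<le> real (r n) * norm ?h"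
      using elim(2) seq_suble[OF y(2), of n] h by (intro mult_right_mono) auto
    also have "\<dots> < \<bar>?d\<bar>" using seq(4)[of "r n"] by (simp add: dist_norm)
    finally show ?thesis .
  qed
qed

lemma continuous_attains_SUP:
  fixes f :: "'a::topological_space \<Rightarrow> real"
  assumes "compact A" "A \<noteq> {}" "continuous_on A f"
  obtains x where "x \<in> A" "(SUP x\<in>A. f x) = f x" "\<And>x'. x' \<in> A \<Longrightarrow> f x' \<le> f x"
proof -
  obtain x where x: "x \<in> A" "\<forall>x'\<in>A. f x' \<le> f x"
    using continuous_attains_sup[OF assms] by blast
  then have "(SUP x\<in>A. f x) = f x" by (intro cSup_eq_maximum) auto
  with x that show ?thesis by blast
qed

text \<open>Danskin's envelope theorem.  Maximisers at nearby points converge to the unique maximiser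
  \<open>y\<close> at \<open>z0\<close>, which squeezes the difference quotient of the maximum between those of \<open>\<phi> y\<close> and
  of the moving maximisers.\<close>

lemma danskin:
  fixes \<phi> :: "'a::metric_space \<Rightarrow> 'c::euclidean_space \<Rightarrow> real"
  assumes A: "compact A" and z0: "z0 \<in> S" and fg: "family_gradient A S z0 \<phi> D"
    and cont: "\<And>z. z \<in> S \<Longrightarrow> continuous_on A (\<lambda>x. \<phi> x z)"
    and y: "y \<in> A" and uniq: "\<And>x. x \<in> A \<Longrightarrow> x \<noteq> y \<Longrightarrow> \<phi> x z0 < \<phi> y z0"
  shows "has_gradient_within (\<lambda>z. SUP x\<in>A. \<phi> x z) (D y) z0 S"
  unfolding has_gradient_within_sequentially
proof (intro allI impI)
  fix zs assume zs: "\<forall>n. zs n \<in> S - {z0}" and zlim: "zs \<longlonglongrightarrow> z0"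
  have ne: "A \<noteq> {}" using y by blast
  have "\<exists>x. x \<in> A \<and> (SUP x\<in>A. \<phi> x (zs n)) = \<phi> x (zs n) \<and> (\<forall>x'\<in>A. \<phi> x' (zs n) \<le> \<phi> x (zs n))" for n
    using continuous_attains_SUP[OF A ne cont] zs by (metis DiffD1)
  then obtain xs where xs: "\<And>n. xs n \<in> A" "\<And>n. (SUP x\<in>A. \<phi> x (zs n)) = \<phi> (xs n) (zs n)"
    "\<And>n x'. x' \<in> A \<Longrightarrow> \<phi> x' (zs n) \<le> \<phi> (xs n) (zs n)"
    by metis
  have sup0: "(SUP x\<in>A. \<phi> x z0) = \<phi> y z0"
    using y uniq by (intro cSup_eq_maximum) (auto, metis less_imp_le order_refl)
  have le0: "\<phi> x z0 \<le> \<phi> y z0" if "x \<in> A" for x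
    using uniq[OF that] by (cases "x = y") auto
  \<comment> \<open>Otherwise a subsequence of maximisers stays at distance \<open>e\<close> from
    \<open>y\<close>, and a further one converges to some \<open>l\<close> in \<open>A\<close>.
    Passing to the limit in the maximality of \<open>xs\<close> shows that \<open>l\<close> is a
    maximiser at \<open>z0\<close>, hence \<open>l = y\<close>.\<close>
  have xlim: "xs \<longlonglongrightarrow> y"
  proof (rule ccontr)
    assume "\<not> xs \<longlonglongrightarrow> y"
    then obtain e where e: "e > 0" "\<not> (\<forall>\<^sub>F n in sequentially. dist (xs n) y < e)"
      unfolding tendsto_iff by blast
    then obtain r :: "nat \<Rightarrow> nat" where r: "strict_mono r" "\<And>n. \<not> dist (xs (r n)) y < e"
      using not_eventually_sequentiallyD[OF e(2)] by blast
    obtain l r' where l: "l \<in> A" "strict_mono r'" "(\<lambda>n. xs (r (r' n))) \<longlonglongrightarrow> l"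
      using seq_compactE[OF A[unfolded compact_eq_seq_compact_metric], of "\<lambda>n. xs (r n)"] xs(1)
      by (auto simp: comp_def)
    have zl: "(\<lambda>n. zs (r (r' n))) \<longlonglongrightarrow> z0"
      using LIMSEQ_subseq_LIMSEQ[OF zlim strict_mono_o[OF r(1) l(2)]] by (simp add: comp_def)
    have "\<phi> y z0 \<le> \<phi> l z0"
    proof (rule LIMSEQ_le)
      show "(\<lambda>n. \<phi> y (zs (r (r' n)))) \<longlonglongrightarrow> \<phi> y z0"
        using zs zl y by (intro family_gradientD(3)[OF fg]) auto
      show "(\<lambda>n. \<phi> (xs (r (r' n))) (zs (r (r' n)))) \<longlonglongrightarrow> \<phi> l z0"
        using zs zl l xs(1) by (intro family_gradientD(3)[OF fg]) auto
    qed (use xs(3)[OF y] in blast)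
    then have "l = y" using uniq[OF l(1)] by force
    with l(3) e(1) have "\<forall>\<^sub>F n in sequentially. dist (xs (r (r' n))) y < e"
      by (auto intro: tendstoD)
    with r(2) show False by simp
  qed
  let ?h = "\<lambda>n. zs n - z0"
  show "(\<lambda>n. ((SUP x\<in>A. \<phi> x (zs n)) - (SUP x\<in>A. \<phi> x z0) - ?h n \<bullet> D y) / norm (?h n)) \<longlonglongrightarrow> 0"
  \<comment> \<open>The lower bound lets \<open>y\<close> compete at \<open>zs n\<close>, the upper
    one lets \<open>xs n\<close> compete at \<open>z0\<close>.\<close>
  proof (rule tendsto_sandwich)
    show "(\<lambda>n. (\<phi> y (zs n) - \<phi> y z0 - ?h n \<bullet> D y) / norm (?h n)) \<longlonglongrightarrow> 0"
      using family_gradientD(2)[OF fg y, of "\<lambda>_. y" zs] y zs zlim by auto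
    show "(\<lambda>n. (\<phi> (xs n) (zs n) - \<phi> (xs n) z0 - ?h n \<bullet> D y) / norm (?h n)) \<longlonglongrightarrow> 0"
      using family_gradientD(2)[OF fg y xs(1) xlim _ zlim] zs by auto
    show "\<forall>\<^sub>F n in sequentially. (\<phi> y (zs n) - \<phi> y z0 - ?h n \<bullet> D y) / norm (?h n)
        \<le> ((SUP x\<in>A. \<phi> x (zs n)) - (SUP x\<in>A. \<phi> x z0) - ?h n \<bullet> D y) / norm (?h n)"
      using xs(3)[OF y] by (intro always_eventually allI divide_right_mono) (auto simp: xs(2) sup0)
    show "\<forall>\<^sub>F n in sequentially. ((SUP x\<in>A. \<phi> x (zs n)) - (SUP x\<in>A. \<phi> x z0) - ?h n \<bullet> D y) / norm (?h n)
       \<le> (\<phi> (xs n) (zs n) - \<phi> (xs n) z0 - ?h n \<bullet> D y) / norm (?h n)"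
      using le0[OF xs(1)] by (intro always_eventually allI divide_right_mono) (auto simp: xs(2) sup0)
  qed
qed

text \<open>Used for the expected maximum in two directions: in the normal variable for
  measurability, and in the point for domination.\<close>

lemma abs_SUP_diff_le:
  fixes u v :: "'a \<Rightarrow> real"
  assumes "A \<noteq> {}" "bdd_above (u ` A)" "bdd_above (v ` A)" "\<And>x. x \<in> A \<Longrightarrow> \<bar>u x - v x\<bar> \<le> e"
  shows "\<bar>(SUP x\<in>A. u x) - (SUP x\<in>A. v x)\<bar> \<le> e"
proof -
  have "u x \<le> (SUP x\<in>A. v x) + e" if "x \<in> A" for x
    using assms(4)[OF that] cSUP_upper[OF that assms(3)] by linarith
  then have "(SUP x\<in>A. u x) \<le> (SUP x\<in>A. v x) + e" using assms(1) by (intro cSUP_least)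
  moreover have "v x \<le> (SUP x\<in>A. u x) + e" if "x \<in> A" for x
    using assms(4)[OF that] cSUP_upper[OF that assms(2)] by linarith
  then have "(SUP x\<in>A. v x) \<le> (SUP x\<in>A. u x) + e" using assms(1) by (intro cSUP_least)
  ultimately show ?thesis by linarith
qed

section \<open>Expectations under the standard normal law\<close>

lemma prob_space_std_normal: "prob_space std_normal"
  using prob_space_normal_density[of 1 0] by simp

lemma integrable_std_normal_abs_power: "integrable std_normal (\<lambda>\<zeta>. \<bar>\<zeta>\<bar> ^ k)"
  using integrable_std_normal_moment_abs[of k] by (simp add: integrable_density)

lemma integrable_std_normal_abs: "integrable std_normal (\<lambda>\<zeta>. \<bar>\<zeta>\<bar>)"
  using integrable_std_normal_abs_power[of 1] by simp

lemma is_arg_max_unique_less: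
  fixes f :: "'a \<Rightarrow> 'b::linorder"
  assumes "\<exists>!x. is_arg_max f P x" "is_arg_max f P y" "P x" "x \<noteq> y"
  shows "f x < f y"
proof (rule ccontr)
  assume "\<not> f x < f y"
  then have "is_arg_max f P x"
    using assms(2,3) by (auto simp: is_arg_max_def not_less)
  with assms(1,2,4) show False by blast
qed

text \<open>Stands in for one-sided or two-sided partial difference quotients on a set that need not
  be open; the steps \<open>d n\<close> may have either sign.\<close>

lemma directional_sequence:
  assumes "partials_meaningful S z0" "i \<in> Basis"
  shows "\<exists>d :: nat \<Rightarrow> real. (\<forall>n. d n \<noteq> 0 \<and> z0 + d n *\<^sub>R i \<in> S) \<and> d \<longlonglongrightarrow> 0"
proof -
  have "\<exists>d. 0 < \<bar>d\<bar> \<and> \<bar>d\<bar> < inverse (real (Suc n)) \<and> z0 + d *\<^sub>R i \<in> S" for n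
    using assms unfolding partials_meaningful_def by simp
  then obtain d where d: "\<And>n. 0 < \<bar>d n\<bar>" "\<And>n. \<bar>d n\<bar> < inverse (real (Suc n))" "\<And>n. z0 + d n *\<^sub>R i \<in> S"
    by metis
  have "d \<longlonglongrightarrow> 0"
    using d(2) by (intro metric_tendsto_imp_tendsto[OF LIMSEQ_inverse_real_of_nat] always_eventually)
      (simp add: less_imp_le)
  then show ?thesis using d by (intro exI[of _ d]) auto
qed

lemma has_gradient_within_directional:
  assumes g: "has_gradient_within f D z0 S" and i: "i \<in> Basis"
    and d: "\<And>n. d n \<noteq> 0" "\<And>n. z0 + d n *\<^sub>R i \<in> S" "d \<longlonglongrightarrow> 0"
  shows "(\<lambda>n. (f (z0 + d n *\<^sub>R i) - f z0) / d n) \<longlonglongrightarrow> D \<bullet> i"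
proof -
  have "i \<noteq> 0" using i by auto
  have "(\<lambda>n. z0 + d n *\<^sub>R i) \<longlonglongrightarrow> z0"
    using tendsto_add[OF tendsto_const[of z0] tendsto_scaleR[OF d(3) tendsto_const[of i]]] by simp
  then have "(\<lambda>n. (f (z0 + d n *\<^sub>R i) - f z0 - d n * (i \<bullet> D)) / \<bar>d n\<bar>) \<longlonglongrightarrow> 0"
    using g[unfolded has_gradient_within_sequentially, rule_format, of "\<lambda>n. z0 + d n *\<^sub>R i"] d i \<open>i \<noteq> 0\<close>
    by simp
  \<comment> \<open>Taking absolute values absorbs the sign that distinguishes division by
    \<open>\<bar>d n\<bar>\<close> from division by \<open>d n\<close>.\<close>
  then have "(\<lambda>n. \<bar>(f (z0 + d n *\<^sub>R i) - f z0 - d n * (i \<bullet> D)) / \<bar>d n\<bar>\<bar>) \<longlonglongrightarrow> 0"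
    by (rule tendsto_rabs_zero)
  moreover have "\<bar>(f (z0 + d n *\<^sub>R i) - f z0 - d n * (i \<bullet> D)) / \<bar>d n\<bar>\<bar> =
      \<bar>(f (z0 + d n *\<^sub>R i) - f z0) / d n - i \<bullet> D\<bar>" for n
    using d(1)[of n] by (simp add: abs_divide divide_diff_eq_iff mult.commute)
  ultimately have "(\<lambda>n. \<bar>(f (z0 + d n *\<^sub>R i) - f z0) / d n - i \<bullet> D\<bar>) \<longlonglongrightarrow> 0"
    by simp
  then show ?thesis
    by (simp add: tendsto_rabs_zero_iff LIM_zero_iff inner_commute)
qed

text \<open>\<open>\<psi>\<close> is built from limits of difference quotients instead of from a
  chosen maximiser, so no measurable selection is involved. Its link to the gradient
  \<open>D\<close> is stated for every maximiser \<open>y\<close>, hence applies to whatever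
  selection is made later.\<close>

lemma expected_maximum_gradient:
  fixes a :: "'a::metric_space \<Rightarrow> real" and s :: "'a \<Rightarrow> 'c::euclidean_space \<Rightarrow> real"
  assumes A: "compact A" "A \<noteq> {}" and a: "continuous_on A a"
    and z0: "z0 \<in> S" "partials_meaningful S z0"
    and fg: "family_gradient A S z0 s D"
    and cont: "\<And>z. z \<in> S \<Longrightarrow> continuous_on A (\<lambda>x. s x z)"
    and uniq: "AE \<zeta> in std_normal. \<exists>!x. is_arg_max (\<lambda>x. a x + s x z0 * \<zeta>) (\<lambda>x. x \<in> A) x"
  obtains \<psi> L where "\<psi> \<in> borel_measurable borel"
    "AE \<zeta> in std_normal. norm (\<psi> \<zeta>) \<le> L * \<bar>\<zeta>\<bar>"
    "AE \<zeta> in std_normal. \<forall>y. is_arg_max (\<lambda>x. a x + s x z0 * \<zeta>) (\<lambda>x. x \<in> A) y \<longrightarrow> \<psi> \<zeta> = \<zeta> *\<^sub>R D y"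
    "has_gradient_within (\<lambda>z. \<integral>\<zeta>. (SUP x\<in>A. a x + s x z * \<zeta>) \<partial>std_normal) (\<integral>\<zeta>. \<psi> \<zeta> \<partial>std_normal) z0 S"
proof -
  interpret N: prob_space std_normal by (rule prob_space_std_normal)
  define F where "F = (\<lambda>z \<zeta>. SUP x\<in>A. a x + s x z * \<zeta>)"
  obtain Ca where Ca: "\<And>x. x \<in> A \<Longrightarrow> \<bar>a x\<bar> \<le> Ca"
    using compact_imp_bounded[OF compact_continuous_image[OF a A(1)]] by (auto simp: bounded_iff)
  \<comment> \<open>\<open>C z\<close> is a bound at one fixed \<open>z\<close>; uniformity near
    \<open>z0\<close> comes only from \<open>L\<close> below.\<close>
  have "\<exists>C. \<forall>x\<in>A. \<bar>s x z\<bar> \<le> C" if "z \<in> S" for z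
    using compact_imp_bounded[OF compact_continuous_image[OF cont[OF that] A(1)]] by (auto simp: bounded_iff)
  then obtain C where C: "\<And>z x. z \<in> S \<Longrightarrow> x \<in> A \<Longrightarrow> \<bar>s x z\<bar> \<le> C z" by metis
  have cont_F: "continuous_on A (\<lambda>x. a x + s x z * \<zeta>)" if "z \<in> S" for z \<zeta>
    using that by (intro continuous_intros a cont)
  have bdd: "bdd_above ((\<lambda>x. a x + s x z * \<zeta>) ` A)" if "z \<in> S" for z \<zeta>
    using compact_imp_bounded[OF compact_continuous_image[OF cont_F[OF that] A(1)]]
    by (rule bounded_imp_bdd_above)
  have F_lip: "\<bar>F z \<zeta> - F z \<zeta>'\<bar> \<le> C z * \<bar>\<zeta> - \<zeta>'\<bar>" if "z \<in> S" for z \<zeta> \<zeta>'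
    unfolding F_def
  proof (rule abs_SUP_diff_le[OF A(2) bdd[OF that] bdd[OF that]])
    fix x assume "x \<in> A"
    have "\<bar>a x + s x z * \<zeta> - (a x + s x z * \<zeta>')\<bar> = \<bar>s x z\<bar> * \<bar>\<zeta> - \<zeta>'\<bar>"
      by (simp add: abs_mult[symmetric] algebra_simps)
    then show "\<bar>a x + s x z * \<zeta> - (a x + s x z * \<zeta>')\<bar> \<le> C z * \<bar>\<zeta> - \<zeta>'\<bar>"
      using C[OF that \<open>x \<in> A\<close>] by (simp add: mult_right_mono)
  qed
  have F_bound: "\<bar>F z \<zeta>\<bar> \<le> Ca + C z * \<bar>\<zeta>\<bar>" if "z \<in> S" for z \<zeta>
    unfolding F_def
  proof (rule cSup_abs_le)
    fix u assume "u \<in> (\<lambda>x. a x + s x z * \<zeta>) ` A"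
    then obtain x where x: "x \<in> A" "u = a x + s x z * \<zeta>" by blast
    have "\<bar>u\<bar> \<le> \<bar>a x\<bar> + \<bar>s x z\<bar> * \<bar>\<zeta>\<bar>"
      unfolding x(2) abs_mult[symmetric] by (rule abs_triangle_ineq)
    also have "\<dots> \<le> Ca + C z * \<bar>\<zeta>\<bar>"
      by (intro add_mono mult_right_mono Ca C that x) simp
    finally show "\<bar>u\<bar> \<le> Ca + C z * \<bar>\<zeta>\<bar>" .
  qed (use A(2) in simp)
  \<comment> \<open>A supremum over a possibly uncountable set: measurability comes from Lipschitz
    continuity in \<open>\<zeta>\<close>.\<close>
  have F_meas[measurable]: "F z \<in> borel_measurable borel" if "z \<in> S" for z
  proof (rule borel_measurable_continuous_onI)
    have "(C z)-lipschitz_on UNIV (F z)"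
    proof (rule lipschitz_onI)
      obtain x where "x \<in> A" using A(2) by blast
      then show "0 \<le> C z" using C[OF that, of x] by simp
    qed (use F_lip[OF that] in \<open>simp add: dist_real_def\<close>)
    then show "continuous_on UNIV (F z)" by (rule lipschitz_on_continuous_on)
  qed
  have F_int: "integrable std_normal (F z)" if "z \<in> S" for z
  proof (rule Bochner_Integration.integrable_bound)
    show "integrable std_normal (\<lambda>\<zeta>. Ca + C z * \<bar>\<zeta>\<bar>)"
      using integrable_std_normal_abs by simp
    show "AE \<zeta> in std_normal. norm (F z \<zeta>) \<le> norm (Ca + C z * \<bar>\<zeta>\<bar>)"
      using F_bound[OF that] by (intro AE_I2) (simp add: order_trans[OF _ abs_ge_self])
  qed (use F_meas[OF that] in simp)
  obtain L e where L: "0 < e" "0 \<le> L"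
    "\<And>x z. x \<in> A \<Longrightarrow> z \<in> S \<Longrightarrow> dist z z0 < e \<Longrightarrow> \<bar>s x z - s x z0\<bar> \<le> L * dist z z0"
    using family_gradient_lipschitz[OF A(1) fg] by metis
  have F_near: "\<bar>F z \<zeta> - F z0 \<zeta>\<bar> \<le> L * dist z z0 * \<bar>\<zeta>\<bar>" if "z \<in> S" "dist z z0 < e" for z \<zeta>
    unfolding F_def
  proof (rule abs_SUP_diff_le[OF A(2) bdd[OF that(1)] bdd[OF z0(1)]])
    fix x assume x: "x \<in> A"
    have "\<bar>a x + s x z * \<zeta> - (a x + s x z0 * \<zeta>)\<bar> = \<bar>s x z - s x z0\<bar> * \<bar>\<zeta>\<bar>"
      by (simp add: abs_mult[symmetric] algebra_simps)
    then show "\<bar>a x + s x z * \<zeta> - (a x + s x z0 * \<zeta>)\<bar> \<le> L * dist z z0 * \<bar>\<zeta>\<bar>"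
      using L(3)[OF x that] by (simp add: mult_right_mono)
  qed
  have F_grad: "has_gradient_within (\<lambda>z. F z \<zeta>) (\<zeta> *\<^sub>R D y) z0 S"
    if u: "\<exists>!x. is_arg_max (\<lambda>x. a x + s x z0 * \<zeta>) (\<lambda>x. x \<in> A) x"
      and y: "is_arg_max (\<lambda>x. a x + s x z0 * \<zeta>) (\<lambda>x. x \<in> A) y" for \<zeta> y
    unfolding F_def
  proof (rule danskin[OF A(1) z0(1) _ cont_F])
    have "family_gradient A S z0 (\<lambda>x z. a x + \<zeta> * s x z) (\<lambda>x. 0 + (\<zeta> *\<^sub>R D x + s x z0 *\<^sub>R 0))"
      by (intro family_gradient_add family_gradient_mult fg family_gradient_const a continuous_intros)
    then show "family_gradient A S z0 (\<lambda>x z. a x + s x z * \<zeta>) (\<lambda>y. \<zeta> *\<^sub>R D y)"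
      by (simp add: mult.commute)
    show "y \<in> A" using y by (simp add: is_arg_max_def)
    show "a x + s x z0 * \<zeta> < a y + s y z0 * \<zeta>" if "x \<in> A" "x \<noteq> y" for x
      using is_arg_max_unique_less[OF u y, of x] that by simp
  qed
  have "\<exists>d :: 'c \<Rightarrow> nat \<Rightarrow> real. \<forall>i\<in>Basis. (\<forall>n. d i n \<noteq> 0 \<and> z0 + d i n *\<^sub>R i \<in> S) \<and> d i \<longlonglongrightarrow> 0"
    by (intro bchoice ballI directional_sequence z0(2))
  then obtain d :: "'c \<Rightarrow> nat \<Rightarrow> real" where d: "\<And>i n. i \<in> Basis \<Longrightarrow> d i n \<noteq> 0"
      "\<And>i n. i \<in> Basis \<Longrightarrow> z0 + d i n *\<^sub>R i \<in> S" "\<And>i. i \<in> Basis \<Longrightarrow> d i \<longlonglongrightarrow> 0"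
    by blast
  define q where "q = (\<lambda>i n \<zeta>. (F (z0 + d i n *\<^sub>R i) \<zeta> - F z0 \<zeta>) / d i n)"
  define \<psi> where "\<psi> = (\<lambda>\<zeta>. \<Sum>i\<in>Basis. lim (\<lambda>n. q i n \<zeta>) *\<^sub>R i)"
  have q_meas: "q i n \<in> borel_measurable borel" if "i \<in> Basis" for i n
    unfolding q_def using F_meas[OF d(2)[OF that]] F_meas[OF z0(1)] by simp
  have \<psi>_meas[measurable]: "\<psi> \<in> borel_measurable borel"
    unfolding \<psi>_def
    by (intro borel_measurable_sum borel_measurable_scaleR borel_measurable_lim_metric q_meas) simp_all
  have q_lim: "(\<lambda>n. q i n \<zeta>) \<longlonglongrightarrow> (\<zeta> *\<^sub>R D y) \<bullet> i"
    if "\<exists>!x. is_arg_max (\<lambda>x. a x + s x z0 * \<zeta>) (\<lambda>x. x \<in> A) x"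
      "is_arg_max (\<lambda>x. a x + s x z0 * \<zeta>) (\<lambda>x. x \<in> A) y" "i \<in> Basis" for \<zeta> y i
    unfolding q_def
    by (rule has_gradient_within_directional[OF F_grad[OF that(1,2)] that(3) d(1)[OF that(3)] d(2)[OF that(3)] d(3)[OF that(3)]])
  have \<psi>_eq: "\<psi> \<zeta> = \<zeta> *\<^sub>R D y"
    if "\<exists>!x. is_arg_max (\<lambda>x. a x + s x z0 * \<zeta>) (\<lambda>x. x \<in> A) x"
      "is_arg_max (\<lambda>x. a x + s x z0 * \<zeta>) (\<lambda>x. x \<in> A) y" for \<zeta> y
  proof -
    have "\<psi> \<zeta> = (\<Sum>i\<in>Basis. ((\<zeta> *\<^sub>R D y) \<bullet> i) *\<^sub>R i)"
      unfolding \<psi>_def using limI[OF q_lim[OF that]] by (intro sum.cong) auto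
    then show ?thesis by (simp only: euclidean_representation)
  qed
  \<comment> \<open>Each component is a limit of quotients bounded by
    \<open>L * \<bar>\<zeta>\<bar>\<close>; the dimension factor arises from bounding the norm by
    the sum of the components.\<close>
  have \<psi>_bound: "norm (\<psi> \<zeta>) \<le> DIM('c) * L * \<bar>\<zeta>\<bar>"
    if u: "\<exists>!x. is_arg_max (\<lambda>x. a x + s x z0 * \<zeta>) (\<lambda>x. x \<in> A) x" for \<zeta>
  proof -
    obtain y where y: "is_arg_max (\<lambda>x. a x + s x z0 * \<zeta>) (\<lambda>x. x \<in> A) y" using u by blast
    have "\<bar>\<psi> \<zeta> \<bullet> i\<bar> \<le> L * \<bar>\<zeta>\<bar>" if i: "i \<in> Basis" for i
    proof (rule LIMSEQ_le_const2)
      show "(\<lambda>n. \<bar>q i n \<zeta>\<bar>) \<longlonglongrightarrow> \<bar>\<psi> \<zeta> \<bullet> i\<bar>"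
        unfolding \<psi>_eq[OF u y] by (intro tendsto_rabs q_lim u y i)
      have "\<forall>\<^sub>F n in sequentially. \<bar>d i n\<bar> < e"
        using tendstoD[OF d(3)[OF i] L(1)] by (simp add: dist_real_def)
      then obtain N where N: "\<And>n. n \<ge> N \<Longrightarrow> \<bar>d i n\<bar> < e" by (auto simp: eventually_sequentially)
      have "\<bar>q i n \<zeta>\<bar> \<le> L * \<bar>\<zeta>\<bar>" if "n \<ge> N" for n
      proof -
        have "\<bar>F (z0 + d i n *\<^sub>R i) \<zeta> - F z0 \<zeta>\<bar> \<le> L * \<bar>d i n\<bar> * \<bar>\<zeta>\<bar>"
          using F_near[OF d(2)[OF i], of n \<zeta>] N[OF that] i by (simp add: dist_norm)
        then show ?thesis using d(1)[OF i, of n] by (simp add: q_def field_simps)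
      qed
      then show "\<exists>N. \<forall>n\<ge>N. \<bar>q i n \<zeta>\<bar> \<le> L * \<bar>\<zeta>\<bar>" by blast
    qed
    then have "(\<Sum>i\<in>Basis. \<bar>\<psi> \<zeta> \<bullet> i\<bar>) \<le> (\<Sum>i\<in>(Basis::'c set). L * \<bar>\<zeta>\<bar>)" by (intro sum_mono)
    then show ?thesis using norm_le_l1[of "\<psi> \<zeta>"] by simp
  qed
  have \<psi>_int: "integrable std_normal \<psi>"
  proof (rule Bochner_Integration.integrable_bound)
    show "integrable std_normal (\<lambda>\<zeta>. DIM('c) * L * \<bar>\<zeta>\<bar>)"
      using integrable_std_normal_abs by simp
    show "AE \<zeta> in std_normal. norm (\<psi> \<zeta>) \<le> norm (DIM('c) * L * \<bar>\<zeta>\<bar>)"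
      using uniq by eventually_elim (use \<psi>_bound L(2) in simp)
  qed simp
  have "has_gradient_within (\<lambda>z. \<integral>\<zeta>. F z \<zeta> \<partial>std_normal) (\<integral>\<zeta>. \<psi> \<zeta> \<partial>std_normal) z0 S"
    unfolding has_gradient_within_sequentially
  proof (intro allI impI)
    fix zs assume zs: "\<forall>n. zs n \<in> S - {z0}" and zlim: "zs \<longlonglongrightarrow> z0"
    have zsS: "zs n \<in> S" and zsn: "norm (zs n - z0) > 0" for n using zs by auto
    let ?r = "\<lambda>n \<zeta>. (F (zs n) \<zeta> - F z0 \<zeta> - (zs n - z0) \<bullet> \<psi> \<zeta>) / norm (zs n - z0)"
    have "\<forall>\<^sub>F n in sequentially. dist (zs n) z0 < e" using zlim L(1) by (rule tendstoD)
    then obtain N where N: "\<And>n. n \<ge> N \<Longrightarrow> dist (zs n) z0 < e" by (auto simp: eventually_sequentially)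
    have rm: "?r n \<in> borel_measurable std_normal" for n
      using F_meas[OF zsS] F_meas[OF z0(1)] by simp
    \<comment> \<open>The shift by \<open>N\<close> keeps all points within distance
      \<open>e\<close> of \<open>z0\<close>, where \<open>F_near\<close> dominates.\<close>
    have "(\<lambda>n. \<integral>\<zeta>. ?r (n + N) \<zeta> \<partial>std_normal) \<longlonglongrightarrow> (\<integral>\<zeta>. 0 \<partial>std_normal)"
    proof (rule integral_dominated_convergence[where w = "\<lambda>\<zeta>. L * \<bar>\<zeta>\<bar> + norm (\<psi> \<zeta>)"])
      show "integrable std_normal (\<lambda>\<zeta>. L * \<bar>\<zeta>\<bar> + norm (\<psi> \<zeta>))"
        using integrable_std_normal_abs \<psi>_int by simp
      show "AE \<zeta> in std_normal. (\<lambda>n. ?r (n + N) \<zeta>) \<longlonglongrightarrow> 0"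
        using uniq
      proof eventually_elim
        case (elim \<zeta>)
        then obtain y where y: "is_arg_max (\<lambda>x. a x + s x z0 * \<zeta>) (\<lambda>x. x \<in> A) y" by blast
        have "(\<lambda>n. ?r n \<zeta>) \<longlonglongrightarrow> 0"
          using F_grad[OF elim y] zs zlim unfolding has_gradient_within_sequentially \<psi>_eq[OF elim y] by blast
        then show ?case by (rule LIMSEQ_ignore_initial_segment)
      qed
      show "AE \<zeta> in std_normal. norm (?r (n + N) \<zeta>) \<le> L * \<bar>\<zeta>\<bar> + norm (\<psi> \<zeta>)" for n
      proof (rule AE_I2)
        fix \<zeta>
        let ?z = "zs (n + N)"
        have "\<bar>F ?z \<zeta> - F z0 \<zeta> - (?z - z0) \<bullet> \<psi> \<zeta>\<bar> \<le> \<bar>F ?z \<zeta> - F z0 \<zeta>\<bar> + \<bar>(?z - z0) \<bullet> \<psi> \<zeta>\<bar>"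
          by (rule abs_triangle_ineq4)
        also have "\<dots> \<le> L * dist ?z z0 * \<bar>\<zeta>\<bar> + norm (?z - z0) * norm (\<psi> \<zeta>)"
          using N by (intro add_mono F_near zsS Cauchy_Schwarz_ineq2) simp
        also have "\<dots> = (L * \<bar>\<zeta>\<bar> + norm (\<psi> \<zeta>)) * norm (?z - z0)"
          by (simp add: dist_norm algebra_simps)
        finally show "norm (?r (n + N) \<zeta>) \<le> L * \<bar>\<zeta>\<bar> + norm (\<psi> \<zeta>)"
          using zsn[of "n + N"] by (simp add: divide_le_eq)
      qed
    qed (use rm in simp_all)
    then have "(\<lambda>n. \<integral>\<zeta>. ?r (n + N) \<zeta> \<partial>std_normal) \<longlonglongrightarrow> 0" by simp
    then have "(\<lambda>n. \<integral>\<zeta>. ?r n \<zeta> \<partial>std_normal) \<longlonglongrightarrow> 0"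
      by (rule LIMSEQ_offset)
    moreover have "(\<integral>\<zeta>. ?r n \<zeta> \<partial>std_normal) = ((\<integral>\<zeta>. F (zs n) \<zeta> \<partial>std_normal) - (\<integral>\<zeta>. F z0 \<zeta> \<partial>std_normal)
       - (zs n - z0) \<bullet> (\<integral>\<zeta>. \<psi> \<zeta> \<partial>std_normal)) / norm (zs n - z0)" for n
      using F_int[OF zsS[of n]] F_int[OF z0(1)] \<psi>_int by simp
    ultimately show "(\<lambda>n. ((\<integral>\<zeta>. F (zs n) \<zeta> \<partial>std_normal) - (\<integral>\<zeta>. F z0 \<zeta> \<partial>std_normal)
       - (zs n - z0) \<bullet> (\<integral>\<zeta>. \<psi> \<zeta> \<partial>std_normal)) / norm (zs n - z0)) \<longlonglongrightarrow> 0" by (simp only:)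
  qed
  moreover have "AE \<zeta> in std_normal. \<forall>y. is_arg_max (\<lambda>x. a x + s x z0 * \<zeta>) (\<lambda>x. x \<in> A) y \<longrightarrow> \<psi> \<zeta> = \<zeta> *\<^sub>R D y"
    using uniq by eventually_elim (use \<psi>_eq in blast)
  moreover have "AE \<zeta> in std_normal. norm (\<psi> \<zeta>) \<le> DIM('c) * L * \<bar>\<zeta>\<bar>"
    using uniq by eventually_elim (rule \<psi>_bound)
  ultimately show ?thesis
    using that[OF \<psi>_meas, of "DIM('c) * L"] unfolding F_def by simp
qed

text \<open>The linear bound on \<open>\<psi>\<close> makes the fourth power of each component
  dominated by a multiple of the fourth absolute moment of a normal variable. All terms share one
  law, so a single constant bounds the centred fourth moments, and the scalar strong law applies to
  each of the finitely many components.\<close>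

lemma (in prob_space) strong_law_std_normal:
  fixes Z :: "nat \<Rightarrow> 'a \<Rightarrow> real" and \<psi> :: "real \<Rightarrow> 'c::euclidean_space"
  assumes Z: "\<And>i. distributed M lborel (Z i) std_normal_density"
    and indep: "indep_vars (\<lambda>_. borel) Z UNIV"
    and \<psi>: "\<psi> \<in> borel_measurable borel" and L: "AE \<zeta> in std_normal. norm (\<psi> \<zeta>) \<le> L * \<bar>\<zeta>\<bar>"
  shows "AE \<omega> in M. (\<lambda>m. (1 / real m) *\<^sub>R (\<Sum>i<m. \<psi> (Z i \<omega>))) \<longlonglongrightarrow> (\<integral>\<zeta>. \<psi> \<zeta> \<partial>std_normal)"
    and "integrable M (\<lambda>\<omega>. \<psi> (Z i \<omega>))"
    and "(\<integral>\<omega>. \<psi> (Z i \<omega>) \<partial>M) = (\<integral>\<zeta>. \<psi> \<zeta> \<partial>std_normal)"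
proof -
  interpret N: prob_space std_normal by (rule prob_space_std_normal)
  note [measurable] = \<psi>
  have Zm[measurable]: "Z i \<in> borel_measurable M" for i
    using indep by (auto simp: indep_vars_def)
  have dZ: "distr M borel (Z i) = std_normal" for i
    using distributed_distr_eq_density[OF Z[of i]] by (simp cong: distr_cong)
  have tr: "integrable M (\<lambda>\<omega>. f (Z i \<omega>)) \<longleftrightarrow> integrable std_normal f"
     "(\<integral>\<omega>. f (Z i \<omega>) \<partial>M) = (\<integral>\<zeta>. f \<zeta> \<partial>std_normal)"
    if "f \<in> borel_measurable borel" for f :: "real \<Rightarrow> 'd::{banach, second_countable_topology}" and i
    using integrable_distr_eq[OF Zm[of i] that] integral_distr[OF Zm[of i] that] by (simp_all add: dZ)
  have \<psi>_int: "integrable std_normal \<psi>"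
  proof (rule Bochner_Integration.integrable_bound)
    show "integrable std_normal (\<lambda>\<zeta>. L * \<bar>\<zeta>\<bar>)" using integrable_std_normal_abs by simp
    show "AE \<zeta> in std_normal. norm (\<psi> \<zeta>) \<le> norm (L * \<bar>\<zeta>\<bar>)" using L by eventually_elim simp
  qed simp
  show "integrable M (\<lambda>\<omega>. \<psi> (Z i \<omega>))" "(\<integral>\<omega>. \<psi> (Z i \<omega>) \<partial>M) = (\<integral>\<zeta>. \<psi> \<zeta> \<partial>std_normal)"
    using tr[OF \<psi>, of i] \<psi>_int by simp_all
  have "AE \<omega> in M. (\<lambda>m. (\<Sum>i<m. \<psi> (Z i \<omega>) \<bullet> b) / real m) \<longlonglongrightarrow> (\<integral>\<zeta>. \<psi> \<zeta> \<partial>std_normal) \<bullet> b"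
    if b: "b \<in> Basis" for b
  proof (rule strong_law_fourth_moment)
    let ?f = "\<lambda>\<zeta>. \<psi> \<zeta> \<bullet> b"
    let ?\<mu> = "(\<integral>\<zeta>. \<psi> \<zeta> \<partial>std_normal) \<bullet> b"
    show "indep_vars (\<lambda>_. borel) (\<lambda>i \<omega>. \<psi> (Z i \<omega>) \<bullet> b) UNIV"
      using indep by (rule indep_vars_compose2[where Y="\<lambda>_ \<zeta>. \<psi> \<zeta> \<bullet> b"]) simp
    have i4: "integrable std_normal (\<lambda>\<zeta>. ?f \<zeta> ^ 4)"
    proof (rule Bochner_Integration.integrable_bound)
      show "integrable std_normal (\<lambda>\<zeta>. L ^ 4 * \<bar>\<zeta>\<bar> ^ 4)"
        using integrable_std_normal_abs_power[of 4] by (intro integrable_mult_right)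
      show "AE \<zeta> in std_normal. norm (?f \<zeta> ^ 4) \<le> norm (L ^ 4 * \<bar>\<zeta>\<bar> ^ 4)"
        using L
      proof eventually_elim
        case (elim \<zeta>)
        have "\<bar>?f \<zeta>\<bar> \<le> L * \<bar>\<zeta>\<bar>" using Basis_le_norm[OF b, of "\<psi> \<zeta>"] elim by simp
        then have "\<bar>?f \<zeta>\<bar> ^ 4 \<le> (L * \<bar>\<zeta>\<bar>) ^ 4" by (intro power_mono) auto
        then show ?case by (simp add: power_mult_distrib)
      qed
    qed simp
    show "integrable M (\<lambda>\<omega>. (\<psi> (Z i \<omega>) \<bullet> b) ^ 4)" for i
      using tr(1)[of "\<lambda>\<zeta>. ?f \<zeta> ^ 4" i] i4 by simp
    show "expectation (\<lambda>\<omega>. \<psi> (Z i \<omega>) \<bullet> b) = ?\<mu>" for i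
      using tr(2)[of ?f i] \<psi>_int by simp
    show "expectation (\<lambda>\<omega>. (\<psi> (Z i \<omega>) \<bullet> b - ?\<mu>) ^ 4) \<le> (\<integral>\<zeta>. (?f \<zeta> - ?\<mu>) ^ 4 \<partial>std_normal)" for i
      using tr(2)[of "\<lambda>\<zeta>. (?f \<zeta> - ?\<mu>) ^ 4" i] by simp
  qed
  then have "AE \<omega> in M. \<forall>b\<in>Basis. (\<lambda>m. (\<Sum>i<m. \<psi> (Z i \<omega>) \<bullet> b) / real m) \<longlonglongrightarrow> (\<integral>\<zeta>. \<psi> \<zeta> \<partial>std_normal) \<bullet> b"
    by (intro AE_finite_allI) simp_all
  then show "AE \<omega> in M. (\<lambda>m. (1 / real m) *\<^sub>R (\<Sum>i<m. \<psi> (Z i \<omega>))) \<longlonglongrightarrow> (\<integral>\<zeta>. \<psi> \<zeta> \<partial>std_normal)"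
  proof eventually_elim
    case (elim \<omega>)
    then show ?case
      by (subst tendsto_componentwise_iff) (simp add: inner_sum_left)
  qed
qed

section \<open>Differentiation of the integrated kernel\<close>

text \<open>Both end points vary, as needed when the base point moves with \<open>x\<close>. The
  mean value theorem is applied to \<open>f v - v \<bullet> g u\<close>, whose gradient
  \<open>g v - g u\<close> is small near \<open>u\<close>; the ball supplies the convexity.\<close>

lemma C1_strictly_differentiable:
  fixes f :: "'c::euclidean_space \<Rightarrow> real"
  assumes U: "open U" and der: "\<And>u. u \<in> U \<Longrightarrow> GDERIV f u :> g u" and g: "continuous_on U g"
    and u: "u \<in> U" and e: "e > 0"
  shows "\<exists>d>0. \<forall>a\<in>ball u d. \<forall>b\<in>ball u d. \<bar>f a - f b - (a - b) \<bullet> g u\<bar> \<le> e * norm (a - b)"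
proof -
  obtain d1 where d1: "d1 > 0" "ball u d1 \<subseteq> U" using U u open_contains_ball by blast
  have "isCont g u" using g U u by (simp add: continuous_on_eq_continuous_at)
  then obtain d2 where d2: "d2 > 0" "\<And>v. dist v u < d2 \<Longrightarrow> dist (g v) (g u) < e"
    using e unfolding continuous_at_eps_delta by blast
  define d where "d = min d1 d2"
  have "\<bar>f a - f b - (a - b) \<bullet> g u\<bar> \<le> e * norm (a - b)" if ab: "a \<in> ball u d" "b \<in> ball u d" for a b
  proof -
    have "norm ((f a - a \<bullet> g u) - (f b - b \<bullet> g u)) \<le> e * norm (a - b)"
    proof (rule differentiable_bound[OF convex_ball _ _ ab])
      fix v assume v: "v \<in> ball u d"
      have "v \<in> U" using v d1 by (auto simp: d_def)
      then have "(f has_derivative (\<lambda>h. h \<bullet> g v)) (at v within ball u d)"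
        using der[of v] by (auto simp: gderiv_def intro: has_derivative_at_withinI)
      then show "((\<lambda>v. f v - v \<bullet> g u) has_derivative (\<lambda>h. h \<bullet> (g v - g u))) (at v within ball u d)"
        by (auto intro!: derivative_eq_intros simp: inner_diff_right)
      show "onorm (\<lambda>h. h \<bullet> (g v - g u)) \<le> e"
      proof (rule onorm_bound)
        fix h
        have "norm (h \<bullet> (g v - g u)) \<le> norm h * norm (g v - g u)"
          using Cauchy_Schwarz_ineq2 by simp
        also have "\<dots> \<le> norm h * e"
          using d2(2)[of v] v by (intro mult_left_mono) (auto simp: d_def dist_norm norm_minus_commute)
        finally show "norm (h \<bullet> (g v - g u)) \<le> e * norm h" by (simp add: mult.commute)
      qed (use e in simp)
    qed
    then show ?thesis by (simp add: inner_diff_left algebra_simps)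
  qed
  then show ?thesis using d1 d2 by (intro exI[of _ d]) (auto simp: d_def)
qed

text \<open>Meant for the slice \<open>z \<mapsto> (z, v)\<close> and the diagonal
  \<open>z \<mapsto> (z, z)\<close> of the kernel. The adjoint of the inner derivative turns the
  chain rule into a gradient.\<close>

lemma C1_on_compose_has_gradient_within:
  fixes f :: "'d::euclidean_space \<Rightarrow> real" and \<gamma> :: "'c::euclidean_space \<Rightarrow> 'd"
  assumes f: "C1_on f S" and \<gamma>: "(\<gamma> has_derivative \<gamma>') (at z within T)" and z: "z \<in> T"
    and sub: "\<gamma> ` T \<subseteq> S"
  shows "\<exists>D. has_gradient_within (\<lambda>z. f (\<gamma> z)) D z T"
proof -
  obtain U f' g where U: "open U" "S \<subseteq> U" "\<And>u. u \<in> S \<Longrightarrow> f' u = f u" "\<And>u. u \<in> U \<Longrightarrow> GDERIV f' u :> g u"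
    using f unfolding C1_on_def by blast
  have "(f' has_derivative (\<lambda>h. h \<bullet> g (\<gamma> z))) (at (\<gamma> z))"
    using U(4)[of "\<gamma> z"] U(2) z sub by (auto simp: gderiv_def)
  from has_derivative_compose[OF \<gamma> this]
  have d: "((\<lambda>z. f' (\<gamma> z)) has_derivative (\<lambda>h. \<gamma>' h \<bullet> g (\<gamma> z))) (at z within T)" .
  then have "((\<lambda>z. f (\<gamma> z)) has_derivative (\<lambda>h. \<gamma>' h \<bullet> g (\<gamma> z))) (at z within T)"
    using z sub U(3) by (rule_tac has_derivative_transform) auto
  moreover have "(\<lambda>h. \<gamma>' h \<bullet> g (\<gamma> z)) = (\<lambda>h. h \<bullet> adjoint \<gamma>' (g (\<gamma> z)))"
    using adjoint_works[OF has_derivative_linear[OF \<gamma>]] by auto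
  ultimately show ?thesis unfolding has_gradient_within_def by auto
qed

lemma has_gradient_within_inverse_sqrt:
  assumes "has_gradient_within q D z S" "q z > 0"
  shows "\<exists>E. has_gradient_within (\<lambda>z. inverse (sqrt (q z))) E z S"
proof -
  have "((\<lambda>u. inverse (sqrt u)) has_real_derivative
      - (inverse (sqrt (q z)) * (inverse (sqrt (q z)) / 2) * inverse (sqrt (q z)))) (at (q z))"
    using assms(2) by (intro DERIV_inverse' DERIV_real_sqrt) auto
  then obtain c where "((\<lambda>u. inverse (sqrt u)) has_real_derivative c) (at (q z))" by blast
  then have "((\<lambda>u. inverse (sqrt u)) has_derivative (*) c) (at (q z))"
    by (simp add: has_field_derivative_def)
  from has_derivative_compose[OF assms(1)[unfolded has_gradient_within_def] this]
  have "((\<lambda>z. inverse (sqrt (q z))) has_derivative (\<lambda>h. h \<bullet> (c *\<^sub>R D))) (at z within S)"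
    by simp
  then show ?thesis unfolding has_gradient_within_def by blast
qed

text \<open>Boundedness of the kernel gives integrability and, by dominated convergence, continuity
  in \<open>x\<close>. The third claim differentiates under the integral: strict differentiability
  at \<open>((y, w), z0)\<close> gives the pointwise limit along moving \<open>xs\<close>, and
  \<open>l\<close> is the integrable Lipschitz bound that dominates.\<close>

lemma integrated_kernel_family_gradient:
  fixes A :: "'a::euclidean_space set" and W :: "'b::euclidean_space set"
    and k :: "'a \<times> 'b \<Rightarrow> 'a \<times> 'b \<Rightarrow> real"
  assumes W: "W \<in> sets borel"
    and p: "\<And>w. w \<in> W \<Longrightarrow> p w \<ge> 0" "set_integrable lborel W p"
    and C1: "C1_on (\<lambda>(u, v). k u v) ((A \<times> W) \<times> (A \<times> W))"
    and bdd: "\<And>u v. u \<in> A \<times> W \<Longrightarrow> v \<in> A \<times> W \<Longrightarrow> \<bar>k u v\<bar> \<le> B"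
  shows "\<And>x z. x \<in> A \<Longrightarrow> z \<in> A \<times> W \<Longrightarrow> set_integrable lborel W (\<lambda>w. k (x, w) z * p w)"
    and "\<And>z. z \<in> A \<times> W \<Longrightarrow> continuous_on A (\<lambda>x. LINT w:W|lborel. k (x, w) z * p w)"
    and "\<lbrakk>z0 \<in> A \<times> W; partials_meaningful (A \<times> W) z0; r > 0;
       set_integrable lborel W (\<lambda>w. l w * p w);
       \<And>x w z. x \<in> A \<Longrightarrow> w \<in> W \<Longrightarrow> z \<in> A \<times> W \<Longrightarrow> dist z z0 < r \<Longrightarrow>
         \<bar>k (x, w) z - k (x, w) z0\<bar> \<le> l w * dist z z0\<rbrakk> \<Longrightarrow>
       \<exists>D. family_gradient A (A \<times> W) z0 (\<lambda>x z. LINT w:W|lborel. k (x, w) z * p w) D"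
proof -
  let ?T = "A \<times> W"
  obtain U f g where U: "open U" "?T \<times> ?T \<subseteq> U" and f': "\<forall>u\<in>?T \<times> ?T. f u = (\<lambda>(u, v). k u v) u"
    and der: "\<And>u. u \<in> U \<Longrightarrow> GDERIV f u :> g u" and g: "continuous_on U g"
    using C1 unfolding C1_on_def by (elim exE conjE) blast
  have f: "f (u, v) = k u v" if "u \<in> ?T" "v \<in> ?T" for u v
    using bspec[OF f', of "(u, v)"] that by simp
  have fcont: "continuous_on U f"
  proof (rule continuous_at_imp_continuous_on, rule ballI)
    fix u assume "u \<in> U"
    then show "isCont f u" using der[of u] by (auto simp: gderiv_def intro: has_derivative_continuous)
  qed
  define I where "I = (\<lambda>x z w. indicator W w *\<^sub>R (k (x, w) z * p w))"
  define pW where "pW = (\<lambda>w. indicator W w *\<^sub>R p w)"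
  have pW: "integrable lborel pW" using p(2) by (simp add: pW_def set_integrable_def)
  have pW0: "pW w \<ge> 0" for w using p(1)[of w] by (simp add: pW_def indicator_def)
  have I_meas: "I x z \<in> borel_measurable lborel" if "x \<in> A" "z \<in> ?T" for x z
  proof -
    have "continuous_on W (\<lambda>w. f ((x, w), z))"
      using that U(2) by (intro continuous_on_compose2[OF fcont]) (auto intro!: continuous_intros)
    then have "continuous_on W (\<lambda>w. k (x, w) z)"
      using f that by (simp cong: continuous_on_cong)
    from borel_measurable_continuous_on_indicator[OF W this]
    \<comment> \<open>\<open>p\<close> is known to be measurable only through its restriction
      \<open>pW\<close>, so the integrand is factored through \<open>pW\<close>.\<close>
    have "(\<lambda>w. (indicator W w *\<^sub>R k (x, w) z) * pW w) \<in> borel_measurable lborel"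
      using pW by (intro borel_measurable_times) (simp_all add: borel_measurable_integrable)
    moreover have "(\<lambda>w. (indicator W w *\<^sub>R k (x, w) z) * pW w) = I x z"
      by (auto simp: I_def pW_def indicator_def)
    ultimately show ?thesis by simp
  qed
  have I_bound: "norm (I x z w) \<le> B * pW w" if "x \<in> A" "z \<in> ?T" for x z w
  proof (cases "w \<in> W")
    case True
    then have "\<bar>k (x, w) z\<bar> * p w \<le> B * p w"
      using that p(1) by (intro mult_right_mono bdd) auto
    then show ?thesis using True p(1)[OF True] by (simp add: I_def pW_def abs_mult)
  qed (simp add: I_def pW_def)
  have I_int: "integrable lborel (I x z)" if "x \<in> A" "z \<in> ?T" for x z
  proof (rule Bochner_Integration.integrable_bound)
    show "integrable lborel (\<lambda>w. B * pW w)" using pW by simp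
    show "AE w in lborel. norm (I x z w) \<le> norm (B * pW w)"
      using I_bound[OF that] by (intro AE_I2) (simp add: order_trans[OF _ abs_ge_self])
  qed (rule I_meas[OF that])
  then show "set_integrable lborel W (\<lambda>w. k (x, w) z * p w)" if "x \<in> A" "z \<in> ?T" for x z
    using that by (simp add: set_integrable_def I_def)
  have LINT_eq: "(LINT w:W|lborel. k (x, w) z * p w) = (\<integral>w. I x z w \<partial>lborel)" for x z
    by (simp add: set_lebesgue_integral_def I_def)
  show cont: "continuous_on A (\<lambda>x. LINT w:W|lborel. k (x, w) z * p w)" if z: "z \<in> ?T" for z
    unfolding continuous_on_sequentially comp_def LINT_eq
  proof (intro allI ballI impI)
    fix xs y assume y: "y \<in> A" and xs: "(\<forall>n. xs n \<in> A) \<and> xs \<longlonglongrightarrow> y"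
    show "(\<lambda>n. \<integral>w. I (xs n) z w \<partial>lborel) \<longlonglongrightarrow> (\<integral>w. I y z w \<partial>lborel)"
    proof (rule integral_dominated_convergence[where w="\<lambda>w. B * pW w"])
      show "AE w in lborel. (\<lambda>n. I (xs n) z w) \<longlonglongrightarrow> I y z w"
      proof (rule AE_I2)
        fix w
        show "(\<lambda>n. I (xs n) z w) \<longlonglongrightarrow> I y z w"
        proof (cases "w \<in> W")
          case True
          have "(\<lambda>n. f ((xs n, w), z)) \<longlonglongrightarrow> f ((y, w), z)"
            using U(2) xs y z True
            by (intro continuous_on_tendsto_compose[OF fcont] tendsto_intros always_eventually) auto
          then have "(\<lambda>n. k (xs n, w) z) \<longlonglongrightarrow> k (y, w) z"
            using f xs y z True by simp
          then show ?thesis unfolding I_def by (intro tendsto_intros)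
        qed (simp add: I_def)
      qed
    qed (use I_meas I_bound pW xs y z in \<open>auto intro!: AE_I2\<close>)
  qed
  show "\<exists>D. family_gradient A ?T z0 (\<lambda>x z. LINT w:W|lborel. k (x, w) z * p w) D"
    if z0: "z0 \<in> ?T" "partials_meaningful ?T z0" and r: "r > 0"
      and l_int: "set_integrable lborel W (\<lambda>w. l w * p w)"
      and l_bound: "\<And>x w z. x \<in> A \<Longrightarrow> w \<in> W \<Longrightarrow> z \<in> ?T \<Longrightarrow> dist z z0 < r \<Longrightarrow>
         \<bar>k (x, w) z - k (x, w) z0\<bar> \<le> l w * dist z z0"
  proof -
    \<comment> \<open>The last component of the gradient of the extension is the gradient of the
      kernel in its second argument; the integral of \<open>G y w\<close> against \<open>p\<close>
      will be the derivative.\<close>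
    define G where "G = (\<lambda>y w. snd (g ((y, w), z0)))"
    define lW where "lW = (\<lambda>w. indicator W w *\<^sub>R (l w * p w))"
    define J where "J = (\<lambda>y w. indicator W w *\<^sub>R (p w *\<^sub>R G y w))"
    have lW: "integrable lborel lW" using l_int by (simp add: lW_def set_integrable_def)
    have strict: "\<exists>d>0. \<forall>x z. x \<in> A \<and> z \<in> ?T \<and> dist x y < d \<and> dist z z0 < d \<longrightarrow>
        \<bar>k (x, w) z - k (x, w) z0 - (z - z0) \<bullet> G y w\<bar> \<le> e * norm (z - z0)"
      if yw: "y \<in> A" "w \<in> W" "e > 0" for y w e
    proof -
      let ?u = "((y, w), z0)"
      have "?u \<in> U" using U(2) yw z0 by auto
      then obtain d where d: "d > 0"
        "\<And>a b. a \<in> ball ?u d \<Longrightarrow> b \<in> ball ?u d \<Longrightarrow> \<bar>f a - f b - (a - b) \<bullet> g ?u\<bar> \<le> e * norm (a - b)"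
        using C1_strictly_differentiable[OF U(1) der g _ yw(3)] by blast
      \<comment> \<open>The halved radius keeps the pair in the ball, since the product distance is
        at most the sum of the two distances.\<close>
      have near: "((x, w), z) \<in> ball ?u d" if "dist x y < d / 2" "dist z z0 < d / 2" for x z
      proof -
        have "dist ?u ((x, w), z) = sqrt ((dist y x)\<^sup>2 + (dist z0 z)\<^sup>2)"
          by (simp add: dist_Pair_Pair)
        also have "\<dots> \<le> dist y x + dist z0 z" by (rule sqrt_sum_squares_le_sum) auto
        finally show ?thesis using that by (simp add: dist_commute)
      qed
      have "\<bar>k (x, w) z - k (x, w) z0 - (z - z0) \<bullet> G y w\<bar> \<le> e * norm (z - z0)"
        if "x \<in> A" "z \<in> ?T" "dist x y < d / 2" "dist z z0 < d / 2" for x z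
        using d(2)[OF near[of x z] near[of x z0]] that \<open>w \<in> W\<close> d(1) z0 f
        by (simp add: G_def norm_Pair inner_Pair inner_prod_def)
      then show ?thesis using d(1) by (intro exI[of _ "d / 2"]) auto
    qed
    have k_grad: "has_gradient_within (k (y, w)) (G y w) z0 ?T" if "y \<in> A" "w \<in> W" for y w
      unfolding has_gradient_within_def has_derivative_within_alt
    proof (intro conjI allI impI)
      fix e :: real assume "0 < e"
      from strict[OF that this] obtain d where "d > 0" "\<forall>x z. x \<in> A \<and> z \<in> ?T \<and> dist x y < d \<and> dist z z0 < d \<longrightarrow>
        \<bar>k (x, w) z - k (x, w) z0 - (z - z0) \<bullet> G y w\<bar> \<le> e * norm (z - z0)" by blast
      then show "\<exists>d>0. \<forall>z\<in>?T. norm (z - z0) < d \<longrightarrow>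
          norm (k (y, w) z - k (y, w) z0 - (z - z0) \<bullet> G y w) \<le> e * norm (z - z0)"
        using that by (intro exI[of _ d]) (auto simp: dist_norm)
    qed (rule bounded_linear_inner_left)
    \<comment> \<open>The Lipschitz bound passes to the gradient through directional quotients. It
      makes \<open>G y\<close> integrable against \<open>p\<close>, which continuity alone does not
      give.\<close>
    have G_bound: "norm (G y w) \<le> DIM('a \<times> 'b) * l w" if y: "y \<in> A" and w: "w \<in> W" for y w
    proof -
      have "\<bar>G y w \<bullet> i\<bar> \<le> l w" if i: "i \<in> Basis" for i
      proof -
        obtain d where d: "\<And>n. d n \<noteq> 0" "\<And>n. z0 + d n *\<^sub>R i \<in> ?T" "d \<longlonglongrightarrow> 0"
          using directional_sequence[OF z0(2) i] by blast
        have "\<forall>\<^sub>F n in sequentially. \<bar>d n\<bar> < r"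
          using tendstoD[OF d(3) r] by (simp add: dist_real_def)
        then have "\<forall>\<^sub>F n in sequentially. \<bar>(k (y, w) (z0 + d n *\<^sub>R i) - k (y, w) z0) / d n\<bar> \<le> l w"
        proof eventually_elim
          case (elim n)
          then show ?case
            using l_bound[OF y w d(2)[of n]] d(1)[of n] i by (simp add: dist_norm divide_le_eq)
        qed
        with tendsto_rabs[OF has_gradient_within_directional[OF k_grad[OF y w] i d]]
        show ?thesis by (rule tendsto_upperbound) simp
      qed
      then have "(\<Sum>i\<in>Basis. \<bar>G y w \<bullet> i\<bar>) \<le> (\<Sum>i\<in>(Basis::('a \<times> 'b) set). l w)" by (intro sum_mono)
      then show ?thesis using norm_le_l1[of "G y w"] by simp
    qed
    have J_bound: "norm (J y w) \<le> DIM('a \<times> 'b) * lW w" if "y \<in> A" for y w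
    proof (cases "w \<in> W")
      case True
      then have "p w * norm (G y w) \<le> p w * (DIM('a \<times> 'b) * l w)"
        using that p(1) by (intro mult_left_mono G_bound)
      then show ?thesis using True p(1)[OF True] by (simp add: J_def lW_def mult_ac del: DIM_prod)
    qed (simp add: J_def lW_def)
    have J_meas: "J y \<in> borel_measurable lborel" if "y \<in> A" for y
    proof -
      have "continuous_on W (\<lambda>w. G y w)" unfolding G_def
        using that U(2) z0 by (intro continuous_on_snd continuous_on_compose2[OF g]) (auto intro!: continuous_intros)
      from borel_measurable_continuous_on_indicator[OF W this]
      have "(\<lambda>w. indicator W w *\<^sub>R G y w) \<in> borel_measurable lborel" by simp
      then have "(\<lambda>w. pW w *\<^sub>R (indicator W w *\<^sub>R G y w)) \<in> borel_measurable lborel"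
        using pW by (rule_tac borel_measurable_scaleR) (simp_all only: borel_measurable_integrable)
      moreover have "(\<lambda>w. pW w *\<^sub>R (indicator W w *\<^sub>R G y w)) = J y"
        by (auto simp: J_def pW_def indicator_def)
      ultimately show ?thesis by simp
    qed
    have J_int: "integrable lborel (J y)" if "y \<in> A" for y
    proof (rule Bochner_Integration.integrable_bound)
      show "integrable lborel (\<lambda>w. DIM('a \<times> 'b) * lW w)" using lW by simp
      show "AE w in lborel. norm (J y w) \<le> norm (DIM('a \<times> 'b) * lW w)"
        using J_bound[OF that] by (intro AE_I2) (simp add: order_trans[OF _ abs_ge_self] del: DIM_prod)
    qed (rule J_meas[OF that])
    have "family_gradient A ?T z0 (\<lambda>x z. \<integral>w. I x z w \<partial>lborel) (\<lambda>y. \<integral>w. J y w \<partial>lborel)"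
    proof (rule family_gradientI)
      show "continuous_on A (\<lambda>x. \<integral>w. I x z0 w \<partial>lborel)" using cont[OF z0(1)] by (simp add: LINT_eq)
      fix y xs zs
      assume y: "y \<in> A" and xs: "\<And>n. xs n \<in> A" "xs \<longlonglongrightarrow> y" and zs: "\<And>n. zs n \<in> ?T - {z0}" "zs \<longlonglongrightarrow> z0"
      have zT: "zs n \<in> ?T" and zn: "norm (zs n - z0) > 0" for n using zs(1)[of n] by auto
      let ?q = "\<lambda>n w. (I (xs n) (zs n) w - I (xs n) z0 w - (zs n - z0) \<bullet> J y w) / norm (zs n - z0)"
      obtain N where N: "\<And>n. n \<ge> N \<Longrightarrow> dist (zs n) z0 < r"
        using tendstoD[OF zs(2) r] by (auto simp: eventually_sequentially)
      have "(\<lambda>n. \<integral>w. ?q (n + N) w \<partial>lborel) \<longlonglongrightarrow> (\<integral>w. 0 \<partial>(lborel :: 'b measure))"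
      proof (rule integral_dominated_convergence[where w="\<lambda>w. lW w + norm (J y w)"])
        show "integrable lborel (\<lambda>w. lW w + norm (J y w))" using lW J_int[OF y] by simp
        show "?q (n + N) \<in> borel_measurable lborel" for n
          using I_meas[OF xs(1) zT] I_meas[OF xs(1) z0(1)] J_meas[OF y]
          by (intro borel_measurable_divide borel_measurable_diff borel_measurable_inner) auto
        show "AE w in lborel. (\<lambda>n. ?q (n + N) w) \<longlonglongrightarrow> 0"
        proof (rule AE_I2, rule LIMSEQ_ignore_initial_segment)
          fix w
          show "(\<lambda>n. ?q n w) \<longlonglongrightarrow> 0"
          proof (cases "w \<in> W")
            case True
            have "(\<lambda>n. (k (xs n, w) (zs n) - k (xs n, w) z0 - (zs n - z0) \<bullet> G y w) / norm (zs n - z0)) \<longlonglongrightarrow> 0"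
            proof (rule tendstoI)
              fix e :: real assume e: "e > 0"
              obtain d where d: "d > 0" "\<And>x z. x \<in> A \<Longrightarrow> z \<in> ?T \<Longrightarrow> dist x y < d \<Longrightarrow> dist z z0 < d \<Longrightarrow>
                 \<bar>k (x, w) z - k (x, w) z0 - (z - z0) \<bullet> G y w\<bar> \<le> e / 2 * norm (z - z0)"
                using strict[OF y True half_gt_zero[OF e]] by blast
              show "\<forall>\<^sub>F n in sequentially. dist ((k (xs n, w) (zs n) - k (xs n, w) z0 - (zs n - z0) \<bullet> G y w) / norm (zs n - z0)) 0 < e"
                using tendstoD[OF xs(2) d(1)] tendstoD[OF zs(2) d(1)]
              proof eventually_elim
                case (elim n)
                have "\<bar>k (xs n, w) (zs n) - k (xs n, w) z0 - (zs n - z0) \<bullet> G y w\<bar> / norm (zs n - z0) \<le> e / 2"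
                  using d(2)[OF xs(1) zT elim] zn[of n] by (simp add: pos_divide_le_eq)
                also have "\<dots> < e" using e by simp
                finally show ?case by (simp add: abs_divide)
              qed
            qed
            from tendsto_mult_left[OF this, of "p w"] True show ?thesis
              by (simp add: I_def J_def algebra_simps)
          qed (simp add: I_def J_def)
        qed
        show "AE w in lborel. norm (?q (n + N) w) \<le> lW w + norm (J y w)" for n
        proof (rule AE_I2)
          fix w
          let ?x = "xs (n + N)" and ?z = "zs (n + N)"
          have 1: "\<bar>I ?x ?z w - I ?x z0 w\<bar> \<le> lW w * norm (?z - z0)"
          proof (cases "w \<in> W")
            case True
            have "p w * \<bar>k (?x, w) ?z - k (?x, w) z0\<bar> \<le> p w * (l w * dist ?z z0)"
              using p(1) True xs(1) zT N by (intro mult_left_mono l_bound) auto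
            moreover have "\<bar>I ?x ?z w - I ?x z0 w\<bar> = p w * \<bar>k (?x, w) ?z - k (?x, w) z0\<bar>"
            proof -
              have "I ?x ?z w - I ?x z0 w = p w * (k (?x, w) ?z - k (?x, w) z0)"
                using True by (simp add: I_def algebra_simps)
              then show ?thesis using p(1)[OF True] by (simp add: abs_mult)
            qed
            ultimately show ?thesis using True by (simp add: lW_def dist_norm mult_ac)
          qed (simp add: I_def lW_def)
          have "\<bar>I ?x ?z w - I ?x z0 w - (?z - z0) \<bullet> J y w\<bar> \<le> \<bar>I ?x ?z w - I ?x z0 w\<bar> + \<bar>(?z - z0) \<bullet> J y w\<bar>"
            by (rule abs_triangle_ineq4)
          also have "\<dots> \<le> lW w * norm (?z - z0) + norm (?z - z0) * norm (J y w)"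
            by (intro add_mono 1 Cauchy_Schwarz_ineq2)
          finally show "norm (?q (n + N) w) \<le> lW w + norm (J y w)"
            using zn[of "n + N"] by (simp add: divide_le_eq algebra_simps)
        qed
      qed simp
      then have "(\<lambda>n. \<integral>w. ?q (n + N) w \<partial>lborel) \<longlonglongrightarrow> 0" by simp
      then have "(\<lambda>n. \<integral>w. ?q n w \<partial>lborel) \<longlonglongrightarrow> 0" by (rule LIMSEQ_offset)
      moreover have "(\<integral>w. ?q n w \<partial>lborel) = ((\<integral>w. I (xs n) (zs n) w \<partial>lborel) - (\<integral>w. I (xs n) z0 w \<partial>lborel)
          - (zs n - z0) \<bullet> (\<integral>w. J y w \<partial>lborel)) / norm (zs n - z0)" for n
        using I_int[OF xs(1) zT] I_int[OF xs(1) z0(1)] J_int[OF y] by simp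
      ultimately show "(\<lambda>n. ((\<integral>w. I (xs n) (zs n) w \<partial>lborel) - (\<integral>w. I (xs n) z0 w \<partial>lborel)
          - (zs n - z0) \<bullet> (\<integral>w. J y w \<partial>lborel)) / norm (zs n - z0)) \<longlonglongrightarrow> 0"
        by (simp only:)
    qed
    then show ?thesis unfolding LINT_eq by blast
  qed
qed

section \<open>Gradient of the value of information\<close>

lemma has_gradient_within_imp_differentiable:
  "has_gradient_within f D z S \<Longrightarrow> f differentiable (at z within S)"
  unfolding has_gradient_within_def differentiable_def by blast

text \<open>The gradient at \<open>(x0, w0)\<close> also differentiates the kernel in the
  \<open>x\<close> direction, while \<open>h\<close> bounds its derivative in \<open>w\<close>;
  \<open>k\<close> and \<open>r\<close> express integrable domination in both directions near the
  point. Continuity of \<open>a\<close> makes the maxima attained,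
  \<open>partials_meaningful\<close> makes gradients unique, and measurability of \<open>y\<close>
  makes each term of the estimator a random variable.\<close>

theorem lemma3:
  fixes A :: "'a::euclidean_space set" and W :: "'b::euclidean_space set"
    and p :: "'b \<Rightarrow> real"
    and M :: "'s measure" and F :: "'a \<times> 'b \<Rightarrow> 's \<Rightarrow> real"
    and \<mu>0 \<mu>n :: "'a \<times> 'b \<Rightarrow> real" and \<Sigma>0 \<Sigma>n :: "'a \<times> 'b \<Rightarrow> 'a \<times> 'b \<Rightarrow> real"
    and lam :: "'a \<times> 'b \<Rightarrow> real"
    and n :: nat and pt :: "nat \<Rightarrow> 'a \<times> 'b" and \<epsilon> :: "nat \<Rightarrow> 's \<Rightarrow> real" and yobs :: "nat \<Rightarrow> real"
    and x0 :: 'a and w0 :: 'b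
    and h :: "'a \<Rightarrow> 'b \<Rightarrow> 'a \<Rightarrow> real" and k :: "'b \<Rightarrow> real" and r :: real
    and P :: "'t measure" and Z :: "nat \<Rightarrow> 't \<Rightarrow> real" and y :: "nat \<Rightarrow> 't \<Rightarrow> 'a"
  defines "a \<equiv> integrated_mean \<mu>n p W"
    and "\<sigma> \<equiv> sigma_tilde \<Sigma>n lam p W (pt ` {..<n})"
    and "V \<equiv> value_of_information (integrated_mean \<mu>n p W)
                (sigma_tilde \<Sigma>n lam p W (pt ` {..<n})) A"
  assumes A: "compact A"
    and W: "W \<in> sets borel"
    and p: "\<And>w. w \<in> W \<Longrightarrow> p w \<ge> 0" "set_integrable lborel W p"
    and M: "prob_space M"
    and prior: "gaussian_process M (A \<times> W) F \<mu>0 \<Sigma>0"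
    and F_integrable:
      "\<And>x. x \<in> A \<Longrightarrow> AE \<omega> in M. set_integrable lborel W (\<lambda>w. F (x, w) \<omega> * p w)"
    and lam_nonneg: "\<And>z. z \<in> A \<times> W \<Longrightarrow> lam z \<ge> 0"
    and sampled: "\<And>i. i < n \<Longrightarrow> pt i \<in> A \<times> W"
    and noise: "observation_noise M (A \<times> W) F n pt lam \<epsilon>"
    and post: "posterior M (A \<times> W) F n (\<lambda>i \<omega>. F (pt i) \<omega> + \<epsilon> i \<omega>) yobs \<mu>n \<Sigma>n"
    and a_cont: "continuous_on A a"
    and \<Sigma>0_C1: "C1_on (\<lambda>(u, v). \<Sigma>0 u v) ((A \<times> W) \<times> (A \<times> W))"
    and \<Sigma>0_bounded: "\<exists>B. \<forall>u\<in>A \<times> W. \<forall>v\<in>A \<times> W. \<bar>\<Sigma>0 u v\<bar> \<le> B"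
    and h_nonneg: "\<And>x w' x'. h x w' x' \<ge> 0"
    and h_integrable:
      "\<And>x x'. x \<in> A \<Longrightarrow> x' \<in> A \<Longrightarrow> set_integrable lborel W (\<lambda>w'. h x w' x' * p w')"
    and h_bound:
      "\<And>x w' x' w. x \<in> A \<Longrightarrow> x' \<in> A \<Longrightarrow> w \<in> W \<Longrightarrow> w' \<in> W \<Longrightarrow>
         \<exists>D. has_gradient_within (\<lambda>v. \<Sigma>0 (x, w') (x', v)) D w W \<and> norm D < h x w' x'"
    and r: "r > 0"
    and k_integrable: "set_integrable lborel W (\<lambda>w'. k w' * p w')"
    and k_bound:
      "\<And>x w' z. x \<in> A \<Longrightarrow> w' \<in> W \<Longrightarrow> z \<in> A \<times> W \<Longrightarrow> dist z (x0, w0) < r \<Longrightarrow>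
         \<bar>\<Sigma>0 (x, w') z - \<Sigma>0 (x, w') (x0, w0)\<bar> \<le> k w' * dist z (x0, w0)"
    and z0: "(x0, w0) \<in> A \<times> W" "partials_meaningful (A \<times> W) (x0, w0)"
    and singleton:
      "AE \<zeta> in std_normal. \<exists>!x'. is_arg_max (\<lambda>x'. a x' + \<sigma> x' (x0, w0) * \<zeta>) (\<lambda>x'. x' \<in> A) x'"
    and \<Sigma>n_pos: "\<Sigma>n (x0, w0) (x0, w0) > 0"
    and lam_C1: "\<exists>e>0. C1_on lam (A \<times> W \<inter> ball (x0, w0) e)"
    and P: "prob_space P"
    and Z_normal: "\<And>i. distributed P lborel (Z i) std_normal_density"
    and Z_indep: "prob_space.indep_vars P (\<lambda>_. borel) Z UNIV"
    and y_measurable: "\<And>i. y i \<in> P \<rightarrow>\<^sub>M restrict_space borel A"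
    and y_argmax:
      "\<And>i. AE \<omega> in P. is_arg_max (\<lambda>x'. a x' + \<sigma> x' (x0, w0) * Z i \<omega>) (\<lambda>x'. x' \<in> A) (y i \<omega>)"
  shows "V differentiable (at (x0, w0) within A \<times> W) \<and>
    (\<forall>x'\<in>A. \<sigma> x' differentiable (at (x0, w0) within A \<times> W)) \<and>
    (AE \<omega> in P.
       (\<lambda>m. (1 / real m) *\<^sub>R (\<Sum>i<m. Z i \<omega> *\<^sub>R gradient (\<sigma> (y i \<omega>)) (A \<times> W) (x0, w0)))
         \<longlonglongrightarrow> gradient V (A \<times> W) (x0, w0)) \<and>
    (\<forall>i. integrable P (\<lambda>\<omega>. Z i \<omega> *\<^sub>R gradient (\<sigma> (y i \<omega>)) (A \<times> W) (x0, w0)) \<and>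
         (\<integral>\<omega>. Z i \<omega> *\<^sub>R gradient (\<sigma> (y i \<omega>)) (A \<times> W) (x0, w0) \<partial>P) =
           gradient V (A \<times> W) (x0, w0))"
proof -
  interpret P: prob_space P by (rule P)
  let ?T = "A \<times> W" and ?z0 = "(x0, w0)"

  \<comment> \<open>Smoothness of the integrated posterior covariance\<close>
  obtain B where B: "\<And>u v. u \<in> ?T \<Longrightarrow> v \<in> ?T \<Longrightarrow> \<bar>\<Sigma>0 u v\<bar> \<le> B" using \<Sigma>0_bounded by blast
  obtain G where G: "\<And>s t. s \<in> ?T \<Longrightarrow> t \<in> ?T \<Longrightarrow>
      \<Sigma>n s t = \<Sigma>0 s t - (\<Sum>i<n. \<Sum>j<n. G i j * (\<Sigma>0 t (pt j) * \<Sigma>0 s (pt i)))"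
    using posterior_covariance(1)[OF M prior sampled lam_nonneg noise post] by blast
  have \<Sigma>n_zero: "\<Sigma>n (pt i) (pt i) = 0" if "i < n" "lam (pt i) = 0" for i
    using posterior_covariance(2)[OF M prior sampled lam_nonneg noise post that] .
  define \<phi> where "\<phi> = (\<lambda>x z. LINT w:W|lborel. \<Sigma>0 (x, w) z * p w)"
  have \<phi>_int: "set_integrable lborel W (\<lambda>w. \<Sigma>0 (x, w) z * p w)" if "x \<in> A" "z \<in> ?T" for x z
    by (rule integrated_kernel_family_gradient(1)[OF W p \<Sigma>0_C1 B that])
  have \<phi>_cont: "continuous_on A (\<lambda>x. \<phi> x z)" if "z \<in> ?T" for z
    unfolding \<phi>_def by (rule integrated_kernel_family_gradient(2)[OF W p \<Sigma>0_C1 B that])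
  obtain D\<phi> where \<phi>_grad: "family_gradient A ?T ?z0 \<phi> D\<phi>"
    using integrated_kernel_family_gradient(3)[OF W p \<Sigma>0_C1 B z0 r k_integrable k_bound]
    unfolding \<phi>_def by blast
  define N where "N = (\<lambda>x z. LINT w:W|lborel. \<Sigma>n (x, w) z * p w)"
  \<comment> \<open>Integrating the posterior formula over \<open>w\<close> separates the variables
    in each correction term: \<open>x\<close> enters only through \<open>\<phi> x (pt i)\<close> and
    \<open>z\<close> only through \<open>\<Sigma>0 z (pt j)\<close>.\<close>
  have N_eq: "N x z = \<phi> x z + (\<Sum>i<n. \<Sum>j<n. (- G i j * \<phi> x (pt i)) * \<Sigma>0 z (pt j))"
    if x: "x \<in> A" and z: "z \<in> ?T" for x z
  proof -
    have "N x z = (\<integral>w. indicator W w *\<^sub>R (\<Sigma>0 (x, w) z * p w)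
        + (\<Sum>i<n. \<Sum>j<n. (- G i j * \<Sigma>0 z (pt j)) * (indicator W w *\<^sub>R (\<Sigma>0 (x, w) (pt i) * p w))) \<partial>lborel)"
      unfolding N_def set_lebesgue_integral_def
    proof (intro Bochner_Integration.integral_cong refl)
      fix w
      show "indicator W w *\<^sub>R (\<Sigma>n (x, w) z * p w) = indicator W w *\<^sub>R (\<Sigma>0 (x, w) z * p w)
        + (\<Sum>i<n. \<Sum>j<n. (- G i j * \<Sigma>0 z (pt j)) * (indicator W w *\<^sub>R (\<Sigma>0 (x, w) (pt i) * p w)))"
        using G[of "(x, w)" z] x z
        by (cases "w \<in> W") (simp_all add: right_diff_distrib sum_distrib_left sum_negf mult_ac)
    qed
    also have "\<dots> = \<phi> x z + (\<Sum>i<n. \<Sum>j<n. (- G i j * \<Sigma>0 z (pt j)) * \<phi> x (pt i))"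
      unfolding \<phi>_def set_lebesgue_integral_def
      using \<phi>_int[OF x z, unfolded set_integrable_def] \<phi>_int[OF x sampled, unfolded set_integrable_def]
      by (subst Bochner_Integration.integral_add)
        (auto intro!: Bochner_Integration.integrable_sum integrable_mult_right simp: Bochner_Integration.integral_sum)
    finally show ?thesis by (simp add: mult_ac)
  qed
  have \<Sigma>0_grad: "\<exists>D. has_gradient_within (\<lambda>z. \<Sigma>0 z v) D ?z0 ?T" if v: "v \<in> ?T" for v
  proof -
    have "\<exists>D. has_gradient_within (\<lambda>z. (\<lambda>(u, v). \<Sigma>0 u v) (z, v)) D ?z0 ?T"
      using v z0(1) by (intro C1_on_compose_has_gradient_within[OF \<Sigma>0_C1, where \<gamma>'="\<lambda>h. (h, 0)"])
        (auto intro!: derivative_eq_intros)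
    then show ?thesis by simp
  qed
  have "\<exists>D. \<forall>j<n. has_gradient_within (\<lambda>z. \<Sigma>0 z (pt j)) (D j) ?z0 ?T"
    using \<Sigma>0_grad[OF sampled] by metis
  then obtain D0 where D0: "\<And>j. j < n \<Longrightarrow> has_gradient_within (\<lambda>z. \<Sigma>0 z (pt j)) (D0 j) ?z0 ?T"
    by blast
  note D0_fam = family_gradient_of_has_gradient_within[OF D0, of _ A]
  have "\<exists>D. has_gradient_within (\<lambda>z. (\<lambda>(u, v). \<Sigma>0 u v) (z, z)) D ?z0 ?T"
    using z0(1) by (intro C1_on_compose_has_gradient_within[OF \<Sigma>0_C1, where \<gamma>'="\<lambda>h. (h, h)"])
      (auto intro!: derivative_eq_intros)
  then obtain D1 where "has_gradient_within (\<lambda>z. \<Sigma>0 z z) D1 ?z0 ?T" by auto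
  note D1_fam = family_gradient_of_has_gradient_within[OF this, of A]
  obtain e1 where e1: "e1 > 0" "C1_on lam (?T \<inter> ball ?z0 e1)" using lam_C1 by blast
  obtain Dl where Dl: "family_gradient A ?T ?z0 (\<lambda>_. lam) Dl"
  proof -
    \<comment> \<open>\<open>lam\<close> is C1 only on a ball around the point, so it is replaced
      there by its extension \<open>f\<close>.\<close>
    obtain U f g where f: "?T \<inter> ball ?z0 e1 \<subseteq> U" "\<And>u. u \<in> ?T \<inter> ball ?z0 e1 \<Longrightarrow> f u = lam u"
      "\<And>u. u \<in> U \<Longrightarrow> GDERIV f u :> g u"
      using e1(2) unfolding C1_on_def by blast
    have "?z0 \<in> U" using f(1) z0(1) e1(1) by auto
    then have "has_gradient_within f (g ?z0) ?z0 ?T"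
      using f(3)[of ?z0] by (auto simp: gderiv_def has_gradient_within_def intro: has_derivative_at_withinI)
    from family_gradient_transform[OF family_gradient_of_has_gradient_within[OF this, of A] z0(1) e1(1)]
    have "family_gradient A ?T ?z0 (\<lambda>_. lam) (\<lambda>_. g ?z0)"
      using f(2) by (simp add: dist_commute)
    then show ?thesis by (rule that)
  qed
  have "\<exists>DN. family_gradient A ?T ?z0 N DN"
  proof -
    have c: "continuous_on A (\<lambda>x. - G i j * \<phi> x (pt i))" if "i < n" for i j
      by (intro continuous_intros \<phi>_cont sampled that)
    \<comment> \<open>Coefficients that do not depend on \<open>z\<close> have gradient 0; these are
      the vanishing summands left by the product rule.\<close>
    have "family_gradient A ?T ?z0 (\<lambda>x z. \<phi> x z + (\<Sum>i<n. \<Sum>j<n. (- G i j * \<phi> x (pt i)) * \<Sigma>0 z (pt j)))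
       (\<lambda>x. D\<phi> x + (\<Sum>i<n. \<Sum>j<n. (- G i j * \<phi> x (pt i)) *\<^sub>R D0 j + \<Sigma>0 ?z0 (pt j) *\<^sub>R 0))"
      by (intro family_gradient_add family_gradient_sum family_gradient_mult family_gradient_const
          \<phi>_grad D0_fam c) auto
    from family_gradient_transform[OF this z0(1) zero_less_one N_eq] show ?thesis by blast
  qed
  then obtain DN where DN: "family_gradient A ?T ?z0 N DN" by blast

  \<comment> \<open>The posterior standard deviation and the gradient of
    \<open>\<sigma>\<close>\<close>
  define q where "q = (\<lambda>z. \<Sigma>n z z + lam z)"
  have q_pos: "q ?z0 > 0" unfolding q_def using \<Sigma>n_pos lam_nonneg[OF z0(1)] by linarith
  have "\<exists>D. has_gradient_within q D ?z0 ?T"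
  proof -
    have fam: "family_gradient A ?T ?z0 (\<lambda>x z. \<Sigma>0 z z + (\<Sum>i<n. \<Sum>j<n. - G i j * (\<Sigma>0 z (pt j) * \<Sigma>0 z (pt i))) + lam z)
       (\<lambda>x. D1 + (\<Sum>i<n. \<Sum>j<n. - G i j *\<^sub>R (\<Sigma>0 ?z0 (pt j) *\<^sub>R D0 i + \<Sigma>0 ?z0 (pt i) *\<^sub>R D0 j)
           + (\<Sigma>0 ?z0 (pt j) * \<Sigma>0 ?z0 (pt i)) *\<^sub>R 0) + Dl x)"
      by (intro family_gradient_add family_gradient_sum family_gradient_mult family_gradient_const
          D1_fam D0_fam Dl continuous_intros) auto
    have "q z = \<Sigma>0 z z + (\<Sum>i<n. \<Sum>j<n. - G i j * (\<Sigma>0 z (pt j) * \<Sigma>0 z (pt i))) + lam z" if "z \<in> ?T" for z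
      using G[OF that that] by (simp add: q_def sum_negf)
    then have "\<exists>D. family_gradient A ?T ?z0 (\<lambda>_. q) D"
      by (intro exI, rule_tac family_gradient_transform[OF fam z0(1) zero_less_one])
    \<comment> \<open>\<open>q\<close> does not depend on \<open>x\<close>; its gradient is read off
      from the family at the member \<open>x0\<close> of \<open>A\<close>.\<close>
    then show ?thesis
      using family_gradient_imp_has_gradient_within[of A ?T ?z0 "\<lambda>_. q"] z0(1) by blast
  qed
  then obtain E where "has_gradient_within (\<lambda>z. inverse (sqrt (q z))) E ?z0 ?T"
    using has_gradient_within_inverse_sqrt q_pos by blast
  note rho_fam = family_gradient_of_has_gradient_within[OF this, of A]
  have \<sigma>_eq: "\<sigma> x z = (if lam z = 0 \<and> z \<in> pt ` {..<n} then 0 else N x z * inverse (sqrt (q z)))" for x z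
    by (simp add: \<sigma>_def sigma_tilde_def N_def q_def divide_inverse)
  obtain e2 where e2: "e2 > 0" "\<And>u. u \<in> pt ` {..<n} \<Longrightarrow> u \<noteq> ?z0 \<Longrightarrow> e2 \<le> dist ?z0 u"
    using finite_set_avoid[of "pt ` {..<n}" ?z0, OF finite_imageI[OF finite_lessThan]] by blast
  \<comment> \<open>Closer than \<open>e2\<close> the only possible sampled point is
    \<open>(x0, w0)\<close> itself. Were it sampled without noise, its posterior variance would be
    0, against \<open>\<Sigma>n_pos\<close>; so the zero branch of \<open>sigma_tilde\<close> never
    occurs here.\<close>
  have \<sigma>_near: "\<sigma> x z = N x z * inverse (sqrt (q z))" if "dist z ?z0 < e2" for x z
  proof -
    have "\<not> (lam z = 0 \<and> z \<in> pt ` {..<n})"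
    proof
      assume *: "lam z = 0 \<and> z \<in> pt ` {..<n}"
      then have "z = ?z0" using e2(2)[of z] that by (auto simp: dist_commute)
      moreover have "\<Sigma>n z z = 0" using * \<Sigma>n_zero by auto
      ultimately show False using \<Sigma>n_pos by simp
    qed
    then show ?thesis by (simp only: \<sigma>_eq if_False)
  qed
  obtain D where \<sigma>_grad: "family_gradient A ?T ?z0 \<sigma> D"
    using family_gradient_transform[OF family_gradient_mult[OF DN rho_fam] z0(1) e2(1)] \<sigma>_near by blast
  have N_cont: "continuous_on A (\<lambda>x. N x z)" if z: "z \<in> ?T" for z
  proof -
    have "continuous_on A (\<lambda>x. \<phi> x z + (\<Sum>i<n. \<Sum>j<n. (- G i j * \<phi> x (pt i)) * \<Sigma>0 z (pt j)))"
      by (intro continuous_intros \<phi>_cont z sampled) auto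
    then show ?thesis using N_eq[OF _ z] by (simp cong: continuous_on_cong)
  qed
  \<comment> \<open>For fixed \<open>z\<close> both the branch and the factor
    \<open>inverse (sqrt (q z))\<close> are constant in \<open>x\<close>, so continuity holds even
    where \<open>q z\<close> is not positive.\<close>
  have \<sigma>_cont: "continuous_on A (\<lambda>x. \<sigma> x z)" if z: "z \<in> ?T" for z
    by (cases "lam z = 0 \<and> z \<in> pt ` {..<n}") (auto simp: \<sigma>_eq intro!: continuous_intros N_cont z)

  \<comment> \<open>Gradient of the value of information\<close>
  have A_ne: "A \<noteq> {}" using z0(1) by auto
  obtain \<psi> L where \<psi>: "\<psi> \<in> borel_measurable borel" "AE \<zeta> in std_normal. norm (\<psi> \<zeta>) \<le> L * \<bar>\<zeta>\<bar>"
      "AE \<zeta> in std_normal. \<forall>y. is_arg_max (\<lambda>x. a x + \<sigma> x ?z0 * \<zeta>) (\<lambda>x. x \<in> A) y \<longrightarrow> \<psi> \<zeta> = \<zeta> *\<^sub>R D y"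
      "has_gradient_within (\<lambda>z. \<integral>\<zeta>. (SUP x\<in>A. a x + \<sigma> x z * \<zeta>) \<partial>std_normal) (\<integral>\<zeta>. \<psi> \<zeta> \<partial>std_normal) ?z0 ?T"
    by (rule expected_maximum_gradient[OF A A_ne a_cont z0 \<sigma>_grad \<sigma>_cont singleton])
  \<comment> \<open>\<open>V\<close> differs from the expected maximum by the maximum of
    \<open>a\<close>, a constant in the point.\<close>
  have V_grad: "has_gradient_within V (\<integral>\<zeta>. \<psi> \<zeta> \<partial>std_normal) ?z0 ?T"
    using \<psi>(4) unfolding has_gradient_within_def V_def a_def \<sigma>_def value_of_information_def
    by (auto intro!: derivative_eq_intros)
  have grad_V: "gradient V ?T ?z0 = (\<integral>\<zeta>. \<psi> \<zeta> \<partial>std_normal)"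
    by (rule gradient_eq[OF z0(2) V_grad])
  have grad_\<sigma>: "gradient (\<sigma> x) ?T ?z0 = D x" if "x \<in> A" for x
    by (rule gradient_eq[OF z0(2) family_gradient_imp_has_gradient_within[OF \<sigma>_grad that]])

  \<comment> \<open>The Monte Carlo estimator\<close>
  have yA: "y i \<omega> \<in> A" if "\<omega> \<in> space P" for i \<omega>
    using measurable_space[OF y_measurable that] by (simp add: space_restrict_space)
  have Zm[measurable]: "Z i \<in> borel_measurable P" for i
    using Z_indep by (auto simp: P.indep_vars_def)
  have dZ: "distr P borel (Z i) = std_normal" for i
    using distributed_distr_eq_density[OF Z_normal[of i]] by (simp cong: distr_cong)
  have AE_eq: "AE \<omega> in P. Z i \<omega> *\<^sub>R gradient (\<sigma> (y i \<omega>)) ?T ?z0 = \<psi> (Z i \<omega>)" for i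
  proof -
    \<comment> \<open>The exceptional null set for \<open>\<zeta>\<close> pulls back to a null set
      of \<open>P\<close>, because \<open>Z i\<close> has the standard normal law.\<close>
    have "AE \<omega> in P. \<forall>y. is_arg_max (\<lambda>x. a x + \<sigma> x ?z0 * Z i \<omega>) (\<lambda>x. x \<in> A) y \<longrightarrow> \<psi> (Z i \<omega>) = Z i \<omega> *\<^sub>R D y"
      using \<psi>(3) unfolding dZ[symmetric, of i] by (rule AE_distrD[OF Zm])
    then show ?thesis
      using y_argmax[of i] AE_space
    proof eventually_elim
      case (elim \<omega>)
      then show ?case using grad_\<sigma>[OF yA[of \<omega> i]] by simp
    qed
  qed
  \<comment> \<open>Almost sure equality with \<open>\<psi> (Z i \<omega>)\<close> transfers
    integrals only between measurable functions. \<open>D\<close> is Borel on \<open>A\<close> as a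
    componentwise limit of difference quotients of \<open>\<sigma> x\<close>, which are continuous
    in \<open>x\<close>, and is then composed with \<open>y i\<close>.\<close>
  have D_meas: "(\<lambda>\<omega>. gradient (\<sigma> (y i \<omega>)) ?T ?z0) \<in> borel_measurable P" for i
  proof -
    have "(\<lambda>x. D x) \<in> borel_measurable (restrict_space borel A)"
    proof (rule borel_measurable_euclidean_space[THEN iffD2], rule ballI)
      fix b :: "'a \<times> 'b" assume b: "b \<in> Basis"
      obtain d where d: "\<And>n. d n \<noteq> 0" "\<And>n. ?z0 + d n *\<^sub>R b \<in> ?T" "d \<longlonglongrightarrow> 0"
        using directional_sequence[OF z0(2) b] by blast
      show "(\<lambda>x. D x \<bullet> b) \<in> borel_measurable (restrict_space borel A)"
      proof (rule borel_measurable_LIMSEQ_real)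
        show "(\<lambda>n. (\<sigma> x (?z0 + d n *\<^sub>R b) - \<sigma> x ?z0) / d n) \<longlonglongrightarrow> D x \<bullet> b"
          if "x \<in> space (restrict_space borel A)" for x
        proof (rule has_gradient_within_directional[OF _ b d])
          show "has_gradient_within (\<sigma> x) (D x) ?z0 ?T"
            using that by (intro family_gradient_imp_has_gradient_within[OF \<sigma>_grad]) (simp add: space_restrict_space)
        qed
        show "(\<lambda>x. (\<sigma> x (?z0 + d n *\<^sub>R b) - \<sigma> x ?z0) / d n) \<in> borel_measurable (restrict_space borel A)" for n
          using d(1)[of n] by (intro borel_measurable_continuous_on_restrict continuous_intros \<sigma>_cont d(2) z0(1)) auto
      qed
    qed
    from measurable_compose[OF y_measurable[of i] this]
    have "(\<lambda>\<omega>. D (y i \<omega>)) \<in> borel_measurable P" .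
    then show ?thesis using grad_\<sigma>[OF yA] by (simp cong: measurable_cong)
  qed
  have term_meas: "(\<lambda>\<omega>. Z i \<omega> *\<^sub>R gradient (\<sigma> (y i \<omega>)) ?T ?z0) \<in> borel_measurable P" for i
    by (intro borel_measurable_scaleR Zm D_meas)
  have \<psi>Z_meas: "(\<lambda>\<omega>. \<psi> (Z i \<omega>)) \<in> borel_measurable P" for i
    using measurable_compose[OF Zm \<psi>(1)] .
  note law = P.strong_law_std_normal[OF Z_normal Z_indep \<psi>(1,2)]
  \<comment> \<open>One null set must serve all terms of the average; there are countably
    many.\<close>
  have "AE \<omega> in P. \<forall>i. Z i \<omega> *\<^sub>R gradient (\<sigma> (y i \<omega>)) ?T ?z0 = \<psi> (Z i \<omega>)"
    using AE_eq by (simp add: AE_all_countable)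
  with law(1) have "AE \<omega> in P. (\<lambda>m. (1 / real m) *\<^sub>R (\<Sum>i<m. Z i \<omega> *\<^sub>R gradient (\<sigma> (y i \<omega>)) ?T ?z0))
      \<longlonglongrightarrow> gradient V ?T ?z0"
    unfolding grad_V by eventually_elim simp
  moreover have "integrable P (\<lambda>\<omega>. Z i \<omega> *\<^sub>R gradient (\<sigma> (y i \<omega>)) ?T ?z0)" for i
    using integrable_cong_AE[OF term_meas \<psi>Z_meas AE_eq] law(2)[of i] by simp
  moreover have "(\<integral>\<omega>. Z i \<omega> *\<^sub>R gradient (\<sigma> (y i \<omega>)) ?T ?z0 \<partial>P) = gradient V ?T ?z0" for i
    using integral_cong_AE[OF term_meas \<psi>Z_meas AE_eq] law(3)[of i] by (simp add: grad_V)
  moreover have "V differentiable (at ?z0 within ?T)"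
    by (rule has_gradient_within_imp_differentiable[OF V_grad])
  moreover have "\<forall>x'\<in>A. \<sigma> x' differentiable (at ?z0 within ?T)"
    using family_gradient_imp_has_gradient_within[OF \<sigma>_grad] has_gradient_within_imp_differentiable by blast
  ultimately show ?thesis by blast
qed

end
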